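(* Let $N$ be a positive integer. The eta product $$S_N(\tau):=\frac{\eta(N\tau)^{\phi(N)}}{\prod_{d\mid N}\eta(d\tau)^{\mu(d)}}$$ has nonnegative Fourier coefficients.
   Context: Here $\tau\in\mathbb{C}$ with $\operatorname{Im}\tau>0$ and $q=\exp(2\pi i\tau)$, so $|q|<1$. The Dedekind eta function is $\eta(\tau)=\exp(\pi i\tau/12)\prod_{n=1}^\infty(1-\exp(2\pi i n\tau))=q^{1/24}\prod_{n=1}^\infty(1-q^n)$. $\phi$ is Euler's totient function, $\mu$ is the Möbius function, and the product in the denominator runs over all positive divisors $d$ of $N$. The Fourier coefficients of $S_N(\tau)$ are the coefficients of its expansion in powers of $q$. This expansion is a single (possibly fractional) power of $q$ times a power series in $q$ with integer coefficients, namely the power series expansion of $E(q^N)^{\phi(N)}/\prod_{d\mid N}E(q^d)^{\mu(d)}$, where $E(q)=\prod_{n=1}^\infty(1-q^n)$. Nonnegativity of the Fourier coefficients means that all coefficients of this power series are $\ge 0$. *)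

theory Defs
  imports
    "HOL-Complex_Analysis.Complex_Analysis"
    "HOL-Number_Theory.Number_Theory"
    "HOL-Computational_Algebra.Squarefree"
begin

definition moebius_mu :: "nat \<Rightarrow> int" where
  "moebius_mu n = (if squarefree n then (- 1) ^ card (prime_factors n) else 0)"

text \<open>
  The value is meaningful for \<open>Im \<tau> > 0\<close>, where the product converges. The index of
  \<^const>\<open>prodinf\<close> starts at \<open>0\<close>, hence the \<open>Suc n\<close>.
\<close>

definition dedekind_eta :: "complex \<Rightarrow> complex" where
  "dedekind_eta \<tau> =
     exp (of_real pi * \<i> * \<tau> / 12) *
     (\<Prod>n. 1 - exp (2 * of_real pi * \<i> * of_nat (Suc n) * \<tau>))"

definition saito_eta_product :: "nat \<Rightarrow> complex \<Rightarrow> complex" where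
  "saito_eta_product N \<tau> =
     dedekind_eta (of_nat N * \<tau>) ^ totient N /
     (\<Prod>d | d dvd N. dedekind_eta (of_nat d * \<tau>) powi moebius_mu d)"

text \<open>
  \<open>has_fourier_expansion f r a\<close> says that \<open>f(\<tau>) = q\<^sup>r (a\<^sub>0 + a\<^sub>1 q + a\<^sub>2 q\<^sup>2 + \<dots>)\<close> on the whole upper
  half-plane, where \<open>q = exp(2\<pi>i\<tau>)\<close> and the fractional power \<open>q\<^sup>r\<close> is read as \<open>exp(2\<pi>ir\<tau>)\<close>, not as
  a branch of a power of the number \<open>q\<close>. Unless \<open>f\<close> vanishes identically, \<open>r\<close> and \<open>a\<close> are
  determined by \<open>f\<close> up to multiplying the power series by a power of \<open>q\<close> and adjusting \<open>r\<close>
  accordingly, so the nonzero coefficients are intrinsic to \<open>f\<close>.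
\<close>

definition has_fourier_expansion ::
    "(complex \<Rightarrow> complex) \<Rightarrow> rat \<Rightarrow> (nat \<Rightarrow> complex) \<Rightarrow> bool" where
  "has_fourier_expansion f r a \<longleftrightarrow>
     (\<forall>\<tau>. Im \<tau> > 0 \<longrightarrow>
        (\<lambda>n. a n * exp (2 * of_real pi * \<i> * \<tau>) ^ n) sums
          (f \<tau> / exp (2 * of_real pi * \<i> * of_rat r * \<tau>)))"

end

theory Submission imports Defs begin

text \<open>
  Write \<open>(a; q) = \<Prod>n\<ge>0. 1 - a q^n\<close> and \<open>E(q) = (q; q)\<close>. By Moebius inversion the denominator
  \<open>\<Prod>d|N. E(q^d)^\<mu>(d)\<close> is the product of \<open>(q^a; q^N)\<close> over the residues \<open>a\<close> coprime to \<open>N\<close>. The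
  eta quotient can therefore be built up prime by prime.

  If \<open>N = p M\<close> with a prime \<open>p\<close> dividing \<open>M\<close>, passing from \<open>M\<close> to \<open>N\<close> multiplies the quotient by
  a power of \<open>E(Q^p)^p / E(Q)\<close> with \<open>Q = q^M\<close>. This is the generating function of \<open>p\<close>-cores: it is the
  sum of \<open>Q^w(n)\<close> over the integer vectors \<open>n\<close> of length \<open>p\<close> with coordinate sum \<open>0\<close>, for an
  explicit nonnegative form \<open>w\<close> (\<open>core_generating_function\<close>).

  If \<open>p\<close> does not divide \<open>M\<close>, the quotient is a product over the residues \<open>b\<close> coprime to \<open>M\<close>.
  A single factor can have negative coefficients, but the product of the factors for \<open>b\<close> and
  \<open>M - b\<close> cannot. With \<open>z = q^b\<close> this product is
  \<open>E(Q^p)^(2p-2) (z^p; Q^p) (Q^p/z^p; Q^p) / ((z; Q) (Q/z; Q))\<close>,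
  and it equals the \<open>p\<close>-core series times the sum of \<open>Q^w(n) (z^(p n_0) + z^(p n_1 + 1) + \<dots> + z^(p n_(p-1) + p - 1))\<close>
  over the same vectors \<open>n\<close> (\<open>mark_sum_product\<close>, an identity of Berkovich and Garvan). All exponents of \<open>q\<close> in
  this sum are nonnegative. For even \<open>N\<close> one takes \<open>p = 2\<close>, so that \<open>M\<close> is always odd and, unless
  \<open>M = 1\<close>, no residue is paired with itself.

  The core series comes from splitting a product of \<open>p\<close> theta series by coordinate sum and applying
  the Jacobi triple product. The second identity is proved by comparing Laurent coefficients. The sum
  \<open>R(z)\<close> over the vectors \<open>n\<close> satisfies a functional equation under \<open>z \<mapsto> q z\<close>, so the product of
  \<open>R(z)\<close> with the theta series \<open>\<theta>(z) = \<Sum>m. (-1)^m q^(m(m-1)/2) z^m\<close> is determined by its coefficients at \<open>z^0, \<dots>, z^(p-1)\<close>. Summing the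
  coefficients over a residue class modulo \<open>p\<close> produces the factor \<open>\<theta>(1) = 0\<close>, which leaves only the
  coefficient at \<open>z^0\<close>; the limit \<open>z \<rightarrow> 1\<close> then fixes the constant.
\<close>

section \<open>The $q$-Pochhammer symbol\<close>

definition qpoch :: "complex \<Rightarrow> complex \<Rightarrow> complex" where
  "qpoch a q = (\<Prod>n. 1 - a * q ^ n)"

abbreviation euler_prod :: "complex \<Rightarrow> complex" where
  "euler_prod q \<equiv> qpoch q q"

lemma abs_convergent_qpoch:
  fixes a q :: complex
  assumes "norm q < 1"
  shows "abs_convergent_prod (\<lambda>n. 1 - a * q ^ n)"
  unfolding abs_convergent_prod_conv_summable
  using assms by (simp add: norm_mult norm_power summable_mult summable_geometric)

lemma convergent_qpoch:
  fixes a q :: complex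
  assumes "norm q < 1"
  shows "convergent_prod (\<lambda>n. 1 - a * q ^ n)"
  using abs_convergent_qpoch[OF assms] by (rule abs_convergent_prod_imp_convergent_prod)

lemma qpoch_LIMSEQ:
  assumes "norm q < 1"
  shows "(\<lambda>n. \<Prod>k<n. 1 - a * q ^ k) \<longlonglongrightarrow> qpoch a q"
  using convergent_prod_LIMSEQ[OF convergent_qpoch[OF assms, of a]]
  unfolding LIMSEQ_lessThan_iff_atMost qpoch_def .

lemma qpoch_Suc:
  assumes "norm q < 1"
  shows "qpoch a q = (1 - a) * qpoch (a * q) q"
proof -
  have "(\<lambda>n. \<Prod>k<Suc n. 1 - a * q ^ k) \<longlonglongrightarrow> qpoch a q"
    using qpoch_LIMSEQ[OF assms, of a] by (rule LIMSEQ_Suc)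
  moreover have "(\<lambda>n. (1 - a) * (\<Prod>k<n. 1 - (a * q) * q ^ k)) \<longlonglongrightarrow> (1 - a) * qpoch (a * q) q"
    by (intro tendsto_intros qpoch_LIMSEQ assms)
  moreover have "(\<Prod>k<Suc n. 1 - a * q ^ k) = (1 - a) * (\<Prod>k<n. 1 - (a * q) * q ^ k)" for n
    by (subst prod.lessThan_Suc_shift) (simp add: mult.assoc)
  ultimately show ?thesis
    using LIMSEQ_unique by auto
qed

lemma qpoch_nonzero:
  assumes "norm q < 1" "\<And>n. a * q ^ n \<noteq> 1"
  shows "qpoch a q \<noteq> 0"
  unfolding qpoch_def
  by (rule prodinf_nonzero) (use convergent_qpoch[OF assms(1)] assms(2) in auto)

lemma norm_power_less_one:
  fixes q :: complex
  assumes "norm q < 1" "n > 0"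
  shows "norm (q ^ n) < 1"
  using assms by (simp add: norm_power power_less_one_iff)

lemma power_neq_one:
  fixes q :: complex
  assumes "norm q < 1" "n > 0"
  shows "q ^ n \<noteq> 1"
  using norm_power_less_one[OF assms] by auto

lemma qpoch_nonzero_disk:
  assumes "norm q < 1" "norm a < 1"
  shows "qpoch a q \<noteq> 0"
proof (rule qpoch_nonzero)
  fix n
  have "norm (a * q ^ n) \<le> norm a"
    using assms by (simp add: norm_mult norm_power mult_left_le power_le_one)
  thus "a * q ^ n \<noteq> 1"
    using assms(2) by auto
qed fact

lemma qpoch_multisection:
  assumes "norm q < 1" "p > 0"
  shows "(\<Prod>i<p. qpoch (a * q ^ i) (q ^ p)) = qpoch a q"
proof -
  have "norm (q ^ p) < 1"
    using assms by (intro norm_power_less_one)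
  hence "(\<lambda>n. \<Prod>i<p. \<Prod>k<n. 1 - (a * q ^ i) * (q ^ p) ^ k)
           \<longlonglongrightarrow> (\<Prod>i<p. qpoch (a * q ^ i) (q ^ p))"
    by (intro tendsto_intros qpoch_LIMSEQ)
  moreover have "(\<Prod>i<p. \<Prod>k<n. 1 - (a * q ^ i) * (q ^ p) ^ k) = (\<Prod>j<n * p. 1 - a * q ^ j)" for n
  proof -
    have "(\<Prod>j<n * p. 1 - a * q ^ j) = (\<Prod>k<n. \<Prod>i<p. 1 - a * q ^ (k * p + i))"
    proof -
      have "(\<Prod>j<n * p. 1 - a * q ^ j) = (\<Prod>k<n. \<Prod>j=k * p..<k * p + p. 1 - a * q ^ j)"
        by (rule prod.nat_group [symmetric])
      moreover have "(\<Prod>j=k * p..<k * p + p. 1 - a * q ^ j) = (\<Prod>i<p. 1 - a * q ^ (k * p + i))" for k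
        using prod.shift_bounds_nat_ivl[of "\<lambda>j. 1 - a * q ^ j" 0 "k * p" p]
        by (simp only: lessThan_atLeast0 add.commute add_0_left add_0_right)
      ultimately show ?thesis
        by (simp only:)
    qed
    also have "\<dots> = (\<Prod>i<p. \<Prod>k<n. 1 - a * q ^ (k * p + i))"
      by (rule prod.swap)
    finally show ?thesis
      by (simp add: power_add mult_ac flip: power_mult)
  qed
  moreover have "(\<lambda>n. \<Prod>j<n * p. 1 - a * q ^ j) \<longlonglongrightarrow> qpoch a q"
  proof -
    have "filterlim (\<lambda>n. n * p) at_top sequentially"
      using assms(2) by (intro filterlim_subseq) (auto simp: strict_mono_def)
    from filterlim_compose[OF qpoch_LIMSEQ[OF assms(1), of a] this] show ?thesis .
  qed
  ultimately show ?thesis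
    using LIMSEQ_unique by auto
qed

text \<open>Tannery's theorem for sums over an arbitrary index set. It is used for the limit in the Jacobi
  triple product and for the continuity of the series of marked vectors at \<open>1\<close>.\<close>

lemma tendsto_infsum_dominated:
  fixes f :: "'a \<Rightarrow> 'b \<Rightarrow> 'c :: banach"
  assumes lim: "\<And>i. i \<in> I \<Longrightarrow> (f i \<longlongrightarrow> b i) G"
  assumes bound: "\<forall>\<^sub>F y in G. \<forall>i\<in>I. norm (f i y) \<le> M i"
  assumes M: "M summable_on I"
  shows "((\<lambda>y. \<Sum>\<^sub>\<infinity>i\<in>I. f i y) \<longlongrightarrow> (\<Sum>\<^sub>\<infinity>i\<in>I. b i)) G"
proof (cases "G = bot")
  case False
  have b: "norm (b i) \<le> M i" if "i \<in> I" for i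
  proof (rule tendsto_upperbound[OF tendsto_norm[OF lim[OF that]] _ False])
    show "\<forall>\<^sub>F y in G. norm (f i y) \<le> M i"
      using bound by eventually_elim (use that in auto)
  qed
  have "b summable_on I"
    by (intro abs_summable_summable[OF Infinite_Sum.abs_summable_on_comparison_test'[OF M]] b)
  hence "(sum b \<longlongrightarrow> infsum b I) (finite_subsets_at_top I)"
    by (simp flip: has_sum_def)
  moreover have "uniform_limit {y. \<forall>i\<in>I. norm (f i y) \<le> M i} (\<lambda>X y. \<Sum>i\<in>X. f i y)
      (\<lambda>y. \<Sum>\<^sub>\<infinity>i\<in>I. f i y) (finite_subsets_at_top I)"
    by (rule Weierstrass_m_test_general[OF _ M]) auto
  moreover have "\<forall>\<^sub>F X in finite_subsets_at_top I. ((\<lambda>y. \<Sum>i\<in>X. f i y) \<longlongrightarrow> sum b X) G"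
    by (rule eventually_finite_subsets_at_top_weakI) (auto intro!: tendsto_sum lim)
  ultimately show ?thesis
    using swap_uniform_limit'[of "\<lambda>X y. \<Sum>i\<in>X. f i y" "sum b" G "finite_subsets_at_top I"
        "infsum b I" "{y. \<forall>i\<in>I. norm (f i y) \<le> M i}" "\<lambda>y. \<Sum>\<^sub>\<infinity>i\<in>I. f i y"] bound
    by simp
qed (simp add: tendsto_bot)

section \<open>Theta series\<close>

text \<open>The exponent \<open>m (m - 1) / 2\<close>, chosen instead of \<open>m\<^sup>2 / 2\<close> so that all exponents are integers.\<close>

definition tri :: "int \<Rightarrow> int" where
  "tri m = m * (m - 1) div 2"

lemma two_tri: "2 * tri m = m * (m - 1)"
  unfolding tri_def by (cases "even m") auto

lemma tri_add_1: "tri (m + 1) = tri m + m"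
  using two_tri[of m] two_tri[of "m + 1"] by (simp add: algebra_simps)

lemma tri_diff_1: "tri (m - 1) = tri m - m + 1"
  using tri_add_1[of "m - 1"] by simp

lemma tri_minus: "tri (- m) = tri m + m"
  using two_tri[of m] two_tri[of "- m"] by (simp add: algebra_simps)

lemma tri_nonneg: "tri m \<ge> 0"
proof -
  have "m * (m - 1) \<ge> 0"
    by (cases "m \<ge> 1") (auto simp: mult_nonpos_nonpos)
  thus ?thesis
    using two_tri[of m] by linarith
qed

lemma tri_0 [simp]: "tri 0 = 0"
  by (simp add: tri_def)

definition theta_term :: "complex \<Rightarrow> complex \<Rightarrow> int \<Rightarrow> complex" where
  "theta_term q x m = q powi tri m * x powi m"

definition theta :: "complex \<Rightarrow> complex \<Rightarrow> complex" where
  "theta q x = (\<Sum>\<^sub>\<infinity>m. theta_term q x m)"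

lemma theta_term_add_1:
  assumes "q \<noteq> 0" "x \<noteq> 0"
  shows "theta_term q x (m + 1) = q powi m * x * theta_term q x m"
  using assms by (simp add: theta_term_def tri_add_1 power_int_add)

lemma theta_term_minus:
  assumes "q \<noteq> 0" "x \<noteq> 0"
  shows "theta_term q x (- m) = theta_term q (q / x) m"
  using assms by (simp add: theta_term_def tri_minus power_int_add power_int_minus_divide
      power_int_divide_distrib)

lemma summable_theta_nat:
  assumes "norm q < 1" "q \<noteq> 0" "x \<noteq> 0"
  shows "summable (\<lambda>n. norm (theta_term q x (int n)))"
proof -
  have "(\<lambda>n. norm q ^ n * norm x) \<longlonglongrightarrow> 0 * norm x"
    using assms by (intro tendsto_intros LIMSEQ_power_zero) auto
  hence "\<forall>\<^sub>F n in sequentially. norm q ^ n * norm x < 1 / 2"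
    by (rule order_tendstoD) auto
  then obtain N where N: "norm q ^ n * norm x < 1 / 2" if "n \<ge> N" for n
    unfolding eventually_sequentially by blast
  show ?thesis
  proof (rule summable_ratio_test[of "1/2" N])
    fix n assume "n \<ge> N"
    have "theta_term q x (int (Suc n)) = q ^ n * x * theta_term q x (int n)"
      using theta_term_add_1[OF assms(2,3), of "int n"] by (simp add: add.commute)
    hence "norm (theta_term q x (int (Suc n))) = (norm q ^ n * norm x) * norm (theta_term q x (int n))"
      by (simp add: norm_mult norm_power)
    also have "\<dots> \<le> 1 / 2 * norm (theta_term q x (int n))"
      using N[OF \<open>n \<ge> N\<close>] by (intro mult_right_mono) auto
    finally show "norm (norm (theta_term q x (int (Suc n)))) \<le> 1 / 2 * norm (norm (theta_term q x (int n)))"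
      by simp
  qed auto
qed

text \<open>The symmetry \<open>theta_term_minus\<close> turns the negative half of the series at \<open>x\<close> into the positive half
  of the series at \<open>q / x\<close>, so the ratio test for nonnegative indices suffices.\<close>

lemma abs_summable_theta:
  assumes "norm q < 1" "q \<noteq> 0" "x \<noteq> 0"
  shows "(\<lambda>m. norm (theta_term q x m)) summable_on UNIV"
proof -
  have pos: "(\<lambda>m. norm (theta_term q y m)) summable_on (range int)" if "y \<noteq> 0" for y
  proof -
    have "(\<lambda>n. norm (theta_term q y (int n))) summable_on UNIV"
      using summable_theta_nat[OF assms(1,2) that] by (intro norm_summable_imp_summable_on) auto
    thus ?thesis
      by (subst summable_on_reindex) (auto simp: o_def)
  qed
  have "(\<lambda>m. norm (theta_term q (q / x) m)) summable_on (range int)"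
    using assms by (intro pos) auto
  hence "(\<lambda>m. norm (theta_term q x m)) summable_on (uminus ` range int)"
    by (subst summable_on_reindex) (use assms in \<open>auto simp: o_def theta_term_minus\<close>)
  with pos[OF assms(3)] have "(\<lambda>m. norm (theta_term q x m)) summable_on (range int \<union> uminus ` range int)"
    by (intro summable_on_union)
  also have "range int \<union> uminus ` range int = UNIV"
    by (auto simp: image_iff) (metis int_cases2 rangeI)
  finally show ?thesis .
qed

lemma has_sum_theta:
  assumes "norm q < 1" "q \<noteq> 0" "x \<noteq> 0"
  shows "(theta_term q x has_sum theta q x) UNIV"
  unfolding theta_def
  by (rule has_sum_infsum[OF abs_summable_summable[OF abs_summable_theta[OF assms]]])

section \<open>The Jacobi triple product\<close>

definition qfact :: "complex \<Rightarrow> nat \<Rightarrow> complex" where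
  "qfact q n = (\<Prod>k<n. 1 - q ^ Suc k)"

lemma qfact_Suc: "qfact q (Suc n) = qfact q n * (1 - q ^ Suc n)"
  by (simp add: qfact_def)

lemma qfact_0 [simp]: "qfact q 0 = 1"
  by (simp add: qfact_def)

lemma qfact_nonzero:
  assumes "norm q < 1"
  shows "qfact q n \<noteq> 0"
proof -
  have "1 - q ^ Suc k \<noteq> 0" for k
    using power_neq_one[OF assms, of "Suc k"] by simp
  thus ?thesis
    by (auto simp: qfact_def simp del: power_Suc)
qed

lemma qfact_LIMSEQ:
  assumes "norm q < 1"
  shows "qfact q \<longlonglongrightarrow> euler_prod q"
  using qpoch_LIMSEQ[OF assms, of q] by (simp add: qfact_def[abs_def])

definition qbinom :: "complex \<Rightarrow> nat \<Rightarrow> nat \<Rightarrow> complex" where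
  "qbinom q n k = (if k \<le> n then qfact q n / (qfact q k * qfact q (n - k)) else 0)"

lemma qbinom_0 [simp]: "norm q < 1 \<Longrightarrow> qbinom q n 0 = 1"
  using qfact_nonzero[of q n] by (simp add: qbinom_def)

lemma qbinom_Suc_Suc:
  assumes "norm q < 1"
  shows "qbinom q (Suc n) (Suc k) = qbinom q n (Suc k) + q ^ (n - k) * qbinom q n k"
proof (cases "k < n")
  case True
  define m where "m = n - Suc k"
  have n: "n = Suc (k + m)"
    using True by (simp add: m_def)
  note nz = qfact_nonzero[OF assms]
  have nz': "1 - q ^ Suc k \<noteq> 0" "1 - q ^ Suc m \<noteq> 0"
    using power_neq_one[OF assms, of "Suc k"] power_neq_one[OF assms, of "Suc m"] by auto
  have [simp]: "Suc (k + m) - k = Suc m"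
    by simp
  have *: "(1 - q ^ Suc m) + q ^ Suc m * (1 - q ^ Suc k) = 1 - q ^ Suc n"
    by (simp add: n algebra_simps power_add)
  have "qbinom q n (Suc k) + q ^ (n - k) * qbinom q n k =
      qfact q n / (qfact q (Suc k) * qfact q m) + q ^ Suc m * (qfact q n / (qfact q k * qfact q (Suc m)))"
    by (simp add: qbinom_def n)
  also have "\<dots> = qfact q n * ((1 - q ^ Suc m) + q ^ Suc m * (1 - q ^ Suc k)) / (qfact q (Suc k) * qfact q (Suc m))"
    using nz nz' unfolding qfact_Suc by (simp add: divide_simps del: power_Suc) (simp add: algebra_simps)
  also have "\<dots> = qbinom q (Suc n) (Suc k)"
    unfolding * by (simp add: qbinom_def n qfact_Suc)
  finally show ?thesis ..
next
  case False
  thus ?thesis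
    using qfact_nonzero[OF assms] by (cases "k = n") (auto simp: qbinom_def)
qed

theorem q_binomial_theorem:
  assumes "norm q < 1" "q \<noteq> 0"
  shows "(\<Prod>k<n. 1 + x * q ^ k) = (\<Sum>j\<le>n. q powi tri (int j) * qbinom q n j * x ^ j)"
proof (induction n)
  case (Suc n)
  define F where "F = (\<lambda>j. q powi tri (int j) * qbinom q n j * x ^ j)"
  have F0: "F (Suc n) = 0"
    by (simp add: F_def qbinom_def)
  have step: "q powi tri (int (Suc j)) * qbinom q (Suc n) (Suc j) * x ^ Suc j = F (Suc j) + x * q ^ n * F j"
    if "j \<le> n" for j
  proof -
    have "q powi tri (int (Suc j)) * q ^ (n - j) = q powi tri (int j) * q ^ n"
    proof -
      have "tri (int (Suc j)) = tri (int j) + int j"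
        using tri_add_1[of "int j"] by (simp add: add.commute)
      thus ?thesis
        using assms that by (simp add: power_int_add flip: power_add)
    qed
    thus ?thesis
      by (simp add: qbinom_Suc_Suc[OF assms(1)] F_def algebra_simps)
  qed
  have "(\<Sum>j\<le>Suc n. q powi tri (int j) * qbinom q (Suc n) j * x ^ j) =
        1 + (\<Sum>j\<le>n. q powi tri (int (Suc j)) * qbinom q (Suc n) (Suc j) * x ^ Suc j)"
    using assms(1) by (subst sum.atMost_Suc_shift) (simp add: tri_def)
  also have "(\<Sum>j\<le>n. q powi tri (int (Suc j)) * qbinom q (Suc n) (Suc j) * x ^ Suc j) =
      (\<Sum>j\<le>n. F (Suc j) + x * q ^ n * F j)"
    by (intro sum.cong refl step) auto
  also have "\<dots> = (\<Sum>j\<le>n. F (Suc j)) + x * q ^ n * (\<Sum>j\<le>n. F j)"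
    by (simp add: sum.distrib sum_distrib_left)
  also have "1 + \<dots> = (F 0 + (\<Sum>j\<le>n. F (Suc j))) + x * q ^ n * (\<Sum>j\<le>n. F j)"
    using assms(1) by (simp add: F_def)
  also have "F 0 + (\<Sum>j\<le>n. F (Suc j)) = (\<Sum>j\<le>n. F j)"
    using F0 by (simp flip: sum.atMost_Suc_shift)
  also have "(\<Sum>j\<le>n. F j) + x * q ^ n * (\<Sum>j\<le>n. F j) = (\<Sum>j\<le>n. F j) * (1 + x * q ^ n)"
    by (simp add: algebra_simps)
  also have "\<dots> = (\<Prod>k<Suc n. 1 + x * q ^ k)"
    using Suc.IH by (simp add: F_def)
  finally show ?case ..
qed (use assms in auto)

text \<open>This is the q-binomial theorem with \<open>2 n\<close> factors, evaluated at \<open>x / q ^ n\<close>: the factors with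
  a negative power of \<open>q\<close> become, up to a monomial, the factors in \<open>q / x\<close>.\<close>

lemma finite_triple_product:
  assumes "norm q < 1" "q \<noteq> 0" "x \<noteq> 0"
  shows "(\<Prod>k<n. 1 + x * q ^ k) * (\<Prod>k<n. 1 + q / x * q ^ k) =
         (\<Sum>m=-int n..int n. qbinom q (2 * n) (nat (int n + m)) * theta_term q x m)"
proof -
  \<comment> \<open>the monomial split off from the factors \<open>1 + x / q ^ k\<close> for \<open>1 \<le> k \<le> n\<close>\<close>
  define c where "c = q powi (tri (int n) - int n * int n) * x ^ n"
  have c: "c \<noteq> 0"
    using assms by (simp add: c_def)
  have "(\<Prod>k<2*n. 1 + x / q ^ n * q ^ k) =
          (\<Prod>k<n. 1 + x / q ^ n * q ^ k) * (\<Prod>k=n..<2*n. 1 + x / q ^ n * q ^ k)"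
    by (subst prod.union_disjoint [symmetric]) (auto intro!: prod.cong)
  also have "(\<Prod>k=n..<2*n. 1 + x / q ^ n * q ^ k) = (\<Prod>k<n. 1 + x * q ^ k)"
    by (rule prod.reindex_bij_witness[of _ "\<lambda>k. k + n" "\<lambda>k. k - n"])
       (use assms in \<open>auto simp: power_diff\<close>)
  also have "(\<Prod>k<n. 1 + x / q ^ n * q ^ k) = (\<Prod>k<n. 1 + x / q ^ Suc k)"
    by (rule prod.reindex_bij_witness[of _ "\<lambda>k. n - Suc k" "\<lambda>k. n - Suc k"])
       (use assms in \<open>auto simp: power_diff Suc_diff_Suc simp del: power_Suc\<close>)
  also have "\<dots> = c * (\<Prod>k<n. 1 + q / x * q ^ k)"
  proof -
    have "(\<Prod>k<m. 1 + x / q ^ Suc k) = q powi (tri (int m) - int m * int m) * x ^ m * (\<Prod>k<m. 1 + q / x * q ^ k)" for m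
    proof (induction m)
      case (Suc m)
      have e: "tri (int (Suc m)) - int (Suc m) * int (Suc m) = (tri (int m) - int m * int m) + (- int (Suc m))"
        using tri_add_1[of "int m"] by (simp add: algebra_simps)
      have "1 + x / q ^ Suc m = q powi (- int (Suc m)) * x * (1 + q / x * q ^ m)"
        using assms by (simp add: power_int_minus field_simps del: of_nat_Suc)
      moreover have "q powi (tri (int (Suc m)) - int (Suc m) * int (Suc m)) =
          q powi (tri (int m) - int m * int m) * q powi (- int (Suc m))"
        unfolding e using assms by (intro power_int_add) auto
      ultimately show ?case
        using Suc.IH by (simp add: algebra_simps)
    qed auto
    thus ?thesis
      by (simp add: c_def)
  qed
  finally have "c * ((\<Prod>k<n. 1 + x * q ^ k) * (\<Prod>k<n. 1 + q / x * q ^ k)) =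
      (\<Sum>j\<le>2*n. q powi tri (int j) * qbinom q (2*n) j * (x / q ^ n) ^ j)"
    by (subst (asm) q_binomial_theorem[OF assms(1,2)]) (simp add: mult_ac)
  also have "\<dots> = (\<Sum>m=-int n..int n. c * (qbinom q (2 * n) (nat (int n + m)) * theta_term q x m))"
  proof (rule sum.reindex_bij_witness[of _ "\<lambda>m. nat (int n + m)" "\<lambda>j. int j - int n"])
    fix j assume "j \<in> {..2 * n}"
    have "tri (int j) - int n * int j = (tri (int n) - int n * int n) + tri (int j - int n)"
      using two_tri[of "int j"] two_tri[of "int n"] two_tri[of "int j - int n"] by (simp add: algebra_simps)
    hence "q powi (tri (int j) - int n * int j) =
        q powi (tri (int n) - int n * int n) * q powi tri (int j - int n)"
      using assms by (simp add: power_int_add)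
    moreover have "q powi (tri (int j) - int n * int j) = q powi tri (int j) / (q ^ n) ^ j"
      using assms by (simp add: power_int_diff power_int_mult)
    ultimately have q_eq: "q powi tri (int j) / (q ^ n) ^ j =
        q powi (tri (int n) - int n * int n) * q powi tri (int j - int n)"
      by simp
    have x_eq: "x ^ j = x ^ n * x powi (int j - int n)"
      using assms by (simp add: power_int_diff)
    have "q powi tri (int j) * qbinom q (2*n) j * (x / q ^ n) ^ j =
        q powi tri (int j) / (q ^ n) ^ j * qbinom q (2*n) j * x ^ j"
      by (simp add: power_divide)
    also have "\<dots> = c * (qbinom q (2 * n) (nat (int n + (int j - int n))) * theta_term q x (int j - int n))"
      unfolding q_eq x_eq by (simp add: c_def theta_term_def)
    finally show "c * (qbinom q (2 * n) (nat (int n + (int j - int n))) * theta_term q x (int j - int n)) =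
        q powi tri (int j) * qbinom q (2*n) j * (x / q ^ n) ^ j" ..
  qed auto
  finally show ?thesis
    using c by (simp flip: sum_distrib_left)
qed

text \<open>In the finite identity every Gaussian binomial coefficient tends to \<open>1 / E(q)\<close>. They are
  bounded uniformly because both \<open>qfact q n\<close> and its inverse converge, so the limit may be taken
  term by term.\<close>

theorem jacobi_triple_product:
  assumes "norm q < 1" "q \<noteq> 0" "x \<noteq> 0"
  shows "theta q x = euler_prod q * qpoch (- x) q * qpoch (- q / x) q"
proof -
  have E: "euler_prod q \<noteq> 0"
    using assms by (intro qpoch_nonzero_disk)
  define g where "g = (\<lambda>m n. if \<bar>m\<bar> \<le> int n then qbinom q (2 * n) (nat (int n + m)) else 0)"
  have g_lim: "g m \<longlonglongrightarrow> 1 / euler_prod q" for m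
  proof -
    have lim: "filterlim (\<lambda>n. nat (int n + k)) at_top sequentially" for k
      unfolding filterlim_at_top
    proof
      fix N
      show "\<forall>\<^sub>F n in sequentially. N \<le> nat (int n + k)"
        using eventually_ge_at_top[of "N + nat \<bar>k\<bar>"] by eventually_elim linarith
    qed
    have lim2: "filterlim (\<lambda>n::nat. 2 * n) at_top sequentially"
      by (intro filterlim_subseq) (auto simp: strict_mono_def)
    have "(\<lambda>n. qfact q (2 * n) / (qfact q (nat (int n + m)) * qfact q (nat (int n + (-m)))))
            \<longlonglongrightarrow> euler_prod q / (euler_prod q * euler_prod q)"
      using E by (intro tendsto_intros filterlim_compose[OF qfact_LIMSEQ[OF assms(1)]] lim lim2) auto
    also have "euler_prod q / (euler_prod q * euler_prod q) = 1 / euler_prod q"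
      using E by simp
    finally show ?thesis
    proof (rule Lim_transform_eventually)
      show "\<forall>\<^sub>F n in sequentially. qfact q (2 * n) / (qfact q (nat (int n + m)) * qfact q (nat (int n + - m))) = g m n"
        using eventually_ge_at_top[of "nat \<bar>m\<bar>"]
      proof eventually_elim
        case (elim n)
        hence "2 * n - nat (int n + m) = nat (int n + - m)" "\<bar>m\<bar> \<le> int n" "nat (int n + m) \<le> 2 * n"
          by linarith+
        thus ?case
          by (simp add: g_def qbinom_def)
      qed
    qed
  qed
  obtain C where C: "norm (g m n) \<le> C" for m n
  proof -
    have "Bseq (qfact q)"
      using qfact_LIMSEQ[OF assms(1)] by (intro convergent_imp_Bseq convergentI)
    then obtain B where B: "norm (qfact q n) \<le> B" "B > 0" for n
      unfolding Bseq_def by blast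
    have "(\<lambda>n. inverse (qfact q n)) \<longlonglongrightarrow> inverse (euler_prod q)"
      by (intro tendsto_intros qfact_LIMSEQ assms E)
    hence "Bseq (\<lambda>n. inverse (qfact q n))"
      by (intro convergent_imp_Bseq convergentI)
    then obtain B' where B': "norm (inverse (qfact q n)) \<le> B'" "B' > 0" for n
      unfolding Bseq_def by blast
    have "norm (qbinom q n k) \<le> B * (B' * B')" for n k
    proof (cases "k \<le> n")
      case True
      hence "norm (qbinom q n k) = norm (qfact q n) * (norm (inverse (qfact q k)) * norm (inverse (qfact q (n - k))))"
        by (simp add: qbinom_def norm_mult norm_divide norm_inverse field_simps)
      also have "\<dots> \<le> B * (B' * B')"
        using B B' by (intro mult_mono) (auto intro: less_imp_le)
      finally show ?thesis .
    qed (use B(2) B'(2) in \<open>auto simp: qbinom_def\<close>)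
    hence "norm (g m n) \<le> B * (B' * B')" for m n
      using B(2) B'(2) by (auto simp: g_def)
    thus ?thesis
      using that by blast
  qed
  have "((\<lambda>n. \<Sum>\<^sub>\<infinity>m. g m n * theta_term q x m) \<longlongrightarrow> (\<Sum>\<^sub>\<infinity>m. 1 / euler_prod q * theta_term q x m)) sequentially"
  proof (rule tendsto_infsum_dominated)
    show "(\<lambda>m. C * norm (theta_term q x m)) summable_on UNIV"
      by (intro summable_on_cmult_right abs_summable_theta assms)
    show "\<forall>\<^sub>F n in sequentially. \<forall>m\<in>UNIV. norm (g m n * theta_term q x m) \<le> C * norm (theta_term q x m)"
      using C by (intro always_eventually) (auto simp: norm_mult intro!: mult_right_mono)
  qed (intro tendsto_intros g_lim)
  also have "(\<lambda>n. \<Sum>\<^sub>\<infinity>m. g m n * theta_term q x m) =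
      (\<lambda>n. (\<Prod>k<n. 1 - (- x) * q ^ k) * (\<Prod>k<n. 1 - (- q / x) * q ^ k))"
  proof
    fix n
    have "(\<Sum>\<^sub>\<infinity>m. g m n * theta_term q x m) = (\<Sum>\<^sub>\<infinity>m\<in>{-int n..int n}. g m n * theta_term q x m)"
      by (rule infsum_cong_neutral) (auto simp: g_def)
    also have "\<dots> = (\<Sum>m=-int n..int n. qbinom q (2 * n) (nat (int n + m)) * theta_term q x m)"
      by (auto simp: g_def intro!: sum.cong)
    finally show "(\<Sum>\<^sub>\<infinity>m. g m n * theta_term q x m) =
        (\<Prod>k<n. 1 - (- x) * q ^ k) * (\<Prod>k<n. 1 - (- q / x) * q ^ k)"
      using finite_triple_product[OF assms, of n] by simp
  qed
  finally have "(\<Sum>\<^sub>\<infinity>m. 1 / euler_prod q * theta_term q x m) = qpoch (- x) q * qpoch (- q / x) q"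
    using tendsto_mult[OF qpoch_LIMSEQ[OF assms(1), of "- x"] qpoch_LIMSEQ[OF assms(1), of "- q / x"]]
    by (intro LIMSEQ_unique)
  moreover have "(\<Sum>\<^sub>\<infinity>m. 1 / euler_prod q * theta_term q x m) = 1 / euler_prod q * theta q x"
    unfolding theta_def by (rule infsum_cmult_right')
  ultimately show ?thesis
    using E by (simp add: field_simps)
qed

section \<open>The lattice sum of cores\<close>

text \<open>A \<open>p\<close>-core partition corresponds to an integer vector of length \<open>p\<close> with coordinate sum \<open>0\<close>:
  on runner \<open>i\<close> of the abacus the topmost bead is displaced by \<open>n i\<close> positions. The \<open>weight\<close> is then
  the size of the partition. Vectors with other coordinate sums are needed because they
  occur in the product of \<open>p\<close> theta series.\<close>

definition charge_vectors :: "nat \<Rightarrow> (nat \<Rightarrow> int) set" where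
  "charge_vectors p = PiE {..<p} (\<lambda>_. UNIV)"

definition weight :: "nat \<Rightarrow> (nat \<Rightarrow> int) \<Rightarrow> int" where
  "weight p n = (\<Sum>i<p. int p * tri (n i) + int i * n i)"

definition charge :: "nat \<Rightarrow> (nat \<Rightarrow> int) \<Rightarrow> int" where
  "charge p n = (\<Sum>i<p. n i)"

definition layer :: "nat \<Rightarrow> int \<Rightarrow> (nat \<Rightarrow> int) set" where
  "layer p s = {n \<in> charge_vectors p. charge p n = s}"

text \<open>Each summand is nonnegative by itself. It increases with \<open>i\<close> if \<open>n i \<ge> 0\<close> and decreases otherwise,
  and at the end points \<open>i = 0\<close> and \<open>i = p\<close> it is \<open>p\<close> times a triangular number.\<close>

lemma weight_nonneg: "weight p n \<ge> 0"
  unfolding weight_def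
proof (intro sum_nonneg)
  fix i assume "i \<in> {..<p}"
  hence i: "int i \<le> int p"
    by simp
  show "int p * tri (n i) + int i * n i \<ge> 0"
  proof (cases "n i \<ge> 0")
    case False
    have "int p * tri (n i) + int i * n i \<ge> int p * tri (n i) + int p * n i"
      using i False mult_right_mono_neg[of "int i" "int p" "n i"] by simp
    also have "int p * tri (n i) + int p * n i = int p * tri (n i + 1)"
      by (simp add: tri_add_1 distrib_left)
    finally show ?thesis
      using tri_nonneg[of "n i + 1"] by (smt (verit) mult_nonneg_nonneg of_nat_0_le_iff)
  qed (use tri_nonneg[of "n i"] in auto)
qed

lemma weight_incr:
  assumes "j < p"
  shows "weight p (n(j := n j + 1)) = weight p n + int p * n j + int j"
proof -
  have "weight p (n(j := n j + 1)) =
     (int p * tri (n j + 1) + int j * (n j + 1)) + (\<Sum>i\<in>{..<p} - {j}. int p * tri (n i) + int i * n i)"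
    unfolding weight_def using assms by (subst sum.remove[of _ j]) (auto intro!: sum.cong)
  also have "\<dots> = weight p n + int p * n j + int j"
    unfolding weight_def using assms by (subst (2) sum.remove[of _ j]) (auto simp: tri_add_1 distrib_left)
  finally show ?thesis .
qed

lemma charge_upd:
  assumes "j < p"
  shows "charge p (n(j := x)) = charge p n - n j + x"
proof -
  have "charge p (n(j := x)) = x + (\<Sum>i\<in>{..<p} - {j}. n i)"
    unfolding charge_def using assms by (subst sum.remove[of _ j]) (auto intro!: sum.cong)
  moreover have "charge p n = n j + (\<Sum>i\<in>{..<p} - {j}. n i)"
    unfolding charge_def using assms by (subst sum.remove[of _ j]) auto
  ultimately show ?thesis
    by simp
qed

lemma upd_charge_vectors:
  assumes "n \<in> charge_vectors p" "j < p"
  shows "n(j := x) \<in> charge_vectors p"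
  using assms by (auto simp: charge_vectors_def PiE_iff extensional_def)

text \<open>In terms of the bead positions \<open>p n_i + i\<close> the shift moves every bead one step down; the bead on runner
  \<open>0\<close> passes to runner \<open>p - 1\<close> of the previous row. This gives a bijection between
  consecutive layers, which is the source of all functional equations below.\<close>

definition shift :: "nat \<Rightarrow> (nat \<Rightarrow> int) \<Rightarrow> nat \<Rightarrow> int" where
  "shift p n = (\<lambda>i\<in>{..<p}. if Suc i = p then n 0 - 1 else n (Suc i))"

definition unshift :: "nat \<Rightarrow> (nat \<Rightarrow> int) \<Rightarrow> nat \<Rightarrow> int" where
  "unshift p n = (\<lambda>i\<in>{..<p}. if i = 0 then n (p - 1) + 1 else n (i - 1))"

lemma weight_shift:
  assumes "p > 0"
  shows "weight p (shift p n) = weight p n - charge p n + 1"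
proof -
  obtain r where r: "p = Suc r"
    using assms gr0_conv_Suc by blast
  define f where "f = (\<lambda>i. int p * tri (n i) + int i * n i)"
  have "weight p (shift p n) =
      (\<Sum>i<r. int p * tri (shift p n i) + int i * shift p n i) + (int p * tri (n 0 - 1) + int r * (n 0 - 1))"
    by (simp add: weight_def r shift_def)
  also have "(\<Sum>i<r. int p * tri (shift p n i) + int i * shift p n i) = (\<Sum>i<r. f (Suc i) - n (Suc i))"
    by (intro sum.cong) (auto simp: r shift_def f_def algebra_simps)
  also have "\<dots> = (\<Sum>i<r. f (Suc i)) - (\<Sum>i<r. n (Suc i))"
    by (rule sum_subtractf)
  also have "(\<Sum>i<r. f (Suc i)) = weight p n - int p * tri (n 0)"
  proof -
    have "weight p n = sum f {..<Suc r}"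
      unfolding weight_def f_def using r by simp
    thus ?thesis
      by (simp add: sum.lessThan_Suc_shift f_def del: sum.lessThan_Suc)
  qed
  also have "(\<Sum>i<r. n (Suc i)) = charge p n - n 0"
    unfolding charge_def by (subst r, subst sum.lessThan_Suc_shift) simp
  finally show ?thesis
    by (simp add: tri_diff_1 r algebra_simps)
qed

lemma charge_shift:
  assumes "p > 0"
  shows "charge p (shift p n) = charge p n - 1"
proof -
  obtain r where r: "p = Suc r"
    using assms gr0_conv_Suc by blast
  have "charge p (shift p n) = (\<Sum>i<r. shift p n i) + (n 0 - 1)"
    by (simp add: charge_def r shift_def)
  also have "(\<Sum>i<r. shift p n i) = (\<Sum>i<r. n (Suc i))"
    by (intro sum.cong) (auto simp: r shift_def)
  also have "(\<Sum>i<r. n (Suc i)) = charge p n - n 0"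
    unfolding charge_def by (subst r, subst sum.lessThan_Suc_shift) simp
  finally show ?thesis
    by simp
qed

lemma shift_charge_vectors: "shift p n \<in> charge_vectors p"
  and unshift_charge_vectors: "unshift p n \<in> charge_vectors p"
  by (auto simp: charge_vectors_def shift_def unshift_def)

lemma unshift_shift:
  assumes "n \<in> charge_vectors p"
  shows "unshift p (shift p n) = n"
proof
  fix i
  show "unshift p (shift p n) i = n i"
    using assms by (cases "i < p") (auto simp: charge_vectors_def shift_def unshift_def PiE_iff extensional_def)
qed

lemma shift_unshift:
  assumes "n \<in> charge_vectors p"
  shows "shift p (unshift p n) = n"
proof
  fix i
  show "shift p (unshift p n) i = n i"
    using assms by (cases "i < p") (auto simp: charge_vectors_def shift_def unshift_def PiE_iff extensional_def)
qed

lemma bij_betw_shift: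
  assumes "p > 0"
  shows "bij_betw (shift p) (layer p s) (layer p (s - 1))"
proof (rule bij_betwI[where g = "unshift p"])
  show "unshift p \<in> layer p (s - 1) \<rightarrow> layer p s"
  proof
    fix n assume n: "n \<in> layer p (s - 1)"
    have "charge p (unshift p n) = charge p (shift p (unshift p n)) + 1"
      using charge_shift[OF assms, of "unshift p n"] by simp
    thus "unshift p n \<in> layer p s"
      using n shift_unshift[of n p] unshift_charge_vectors[of p n] by (simp add: layer_def)
  qed
qed (use charge_shift[OF assms] shift_charge_vectors shift_unshift unshift_shift in \<open>auto simp: layer_def\<close>)

lemma abs_summable_prod_PiE:
  fixes f :: "'a \<Rightarrow> 'b \<Rightarrow> complex"
  assumes "finite A" "\<And>x. x \<in> A \<Longrightarrow> countable (B x)"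
    and "\<And>x. x \<in> A \<Longrightarrow> (\<lambda>y. norm (f x y)) summable_on B x"
  shows "(\<lambda>g. norm (\<Prod>x\<in>A. f x (g x))) summable_on PiE A B"
  using abs_summable_on_prod_PiE[of A B f] assms by (simp add: abs_summable_equivalent)

lemma abs_summable_times:
  fixes f :: "'a \<Rightarrow> complex" and g :: "'b \<Rightarrow> complex"
  assumes "(\<lambda>x. norm (f x)) summable_on A" "(\<lambda>y. norm (g y)) summable_on B"
  shows "(\<lambda>(x, y). norm (f x * g y)) summable_on (A \<times> B)"
proof (rule summable_on_SigmaI[where g = "\<lambda>x. norm (f x) * (\<Sum>\<^sub>\<infinity>y\<in>B. norm (g y))"])
  fix x assume "x \<in> A"
  show "((\<lambda>y. case (x, y) of (x, y) \<Rightarrow> norm (f x * g y)) has_sum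
          norm (f x) * (\<Sum>\<^sub>\<infinity>y\<in>B. norm (g y))) B"
    using has_sum_cmult_right[OF has_sum_infsum[OF assms(2)], of "norm (f x)"] by (simp add: norm_mult)
qed (use assms in \<open>auto intro: summable_on_cmult_left\<close>)

lemma prod_theta_terms:
  fixes q :: complex
  assumes "q \<noteq> 0"
  shows "(\<Prod>i<p. theta_term (q ^ p) (q ^ i) (n i)) = q powi weight p n"
proof -
  have "(\<Prod>i\<in>A. q powi f i) = q powi (\<Sum>i\<in>A. f i)" for f and A :: "nat set"
    by (induction A rule: infinite_finite_induct) (use assms in \<open>auto simp: power_int_add\<close>)
  moreover have "theta_term (q ^ p) (q ^ i) (n i) = q powi (int p * tri (n i) + int i * n i)" for i
    using assms by (simp add: theta_term_def power_int_add power_int_mult)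
  ultimately show ?thesis
    by (simp only: weight_def)
qed

lemma abs_summable_weight:
  fixes q :: complex
  assumes "norm q < 1" "q \<noteq> 0" "p > 0"
  shows "(\<lambda>n. norm (q powi weight p n)) summable_on charge_vectors p"
proof -
  have "(\<lambda>n. norm (\<Prod>i<p. theta_term (q ^ p) (q ^ i) (n i))) summable_on charge_vectors p"
    unfolding charge_vectors_def using assms
    by (intro abs_summable_prod_PiE abs_summable_theta norm_power_less_one) auto
  thus ?thesis
    by (simp only: prod_theta_terms[OF assms(2)])
qed

definition layer_sum :: "nat \<Rightarrow> complex \<Rightarrow> int \<Rightarrow> complex" where
  "layer_sum p q s = (\<Sum>\<^sub>\<infinity>n\<in>layer p s. q powi weight p n)"

lemma abs_summable_layer:
  fixes q :: complex
  assumes "norm q < 1" "q \<noteq> 0" "p > 0"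
  shows "(\<lambda>n. norm (q powi weight p n)) summable_on layer p s"
  by (rule summable_on_subset_banach[OF abs_summable_weight[OF assms]]) (auto simp: layer_def)

lemma has_sum_layer:
  assumes "norm q < 1" "q \<noteq> 0" "p > 0"
  shows "((\<lambda>n. q powi weight p n) has_sum layer_sum p q s) (layer p s)"
  unfolding layer_sum_def
  by (rule has_sum_infsum[OF abs_summable_summable[OF abs_summable_layer[OF assms]]])

lemma layer_sum_step:
  assumes "norm q < 1" "q \<noteq> 0" "p > 0"
  shows "layer_sum p q (s + 1) = q powi s * layer_sum p q s"
proof -
  have "layer_sum p q s = (\<Sum>\<^sub>\<infinity>n\<in>layer p (s + 1). q powi weight p (shift p n))"
    unfolding layer_sum_def
    using infsum_reindex_bij_betw[OF bij_betw_shift[OF assms(3), of "s + 1"], of "\<lambda>n. q powi weight p n"] by simp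
  also have "\<dots> = (\<Sum>\<^sub>\<infinity>n\<in>layer p (s + 1). q powi (- s) * q powi weight p n)"
  proof (rule infsum_cong)
    fix n assume "n \<in> layer p (s + 1)"
    hence *: "weight p (shift p n) = - s + weight p n"
      using weight_shift[OF assms(3), of n] by (simp add: layer_def)
    show "q powi weight p (shift p n) = q powi (- s) * q powi weight p n"
      unfolding * using assms by (intro power_int_add) auto
  qed
  also have "\<dots> = q powi (- s) * layer_sum p q (s + 1)"
    unfolding layer_sum_def by (rule infsum_cmult_right')
  finally show ?thesis
    using assms by (simp add: power_int_minus field_simps)
qed

lemma layer_sum_eq:
  assumes "norm q < 1" "q \<noteq> 0" "p > 0"
  shows "layer_sum p q s = theta_term q 1 s * layer_sum p q 0"
proof (induction s rule: int_induct[where k = 0])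
  case (step1 i)
  thus ?case
    using layer_sum_step[OF assms, of i] theta_term_add_1[of q 1 i] assms by simp
next
  case (step2 i)
  have "q powi (i - 1) * layer_sum p q (i - 1) = q powi (i - 1) * (theta_term q 1 (i - 1) * layer_sum p q 0)"
    using step2 layer_sum_step[OF assms, of "i - 1"] theta_term_add_1[of q 1 "i - 1"] assms by simp
  thus ?case
    using assms by simp
qed (simp add: theta_term_def)

text \<open>The product of the theta series \<open>theta (q^p) (q^i)\<close> over \<open>i < p\<close> is the sum over all charge vectors.
  Splitting it by coordinate sum gives \<open>layer_sum p q 0 * theta q 1\<close>, because the layer sums are
  proportional to the terms of \<open>theta q 1\<close>. Evaluating all theta series by the triple product and
  recombining the residue classes yields the quotient.\<close>

theorem core_generating_function:
  assumes "norm q < 1" "q \<noteq> 0" "p > 0"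
  shows "layer_sum p q 0 = euler_prod (q ^ p) ^ p / euler_prod q"
proof -
  have qp: "norm (q ^ p) < 1" "q ^ p \<noteq> 0"
    using assms norm_power_less_one by auto
  have E: "euler_prod q \<noteq> 0"
    using assms by (intro qpoch_nonzero_disk)
  have nz: "qpoch (-1) q \<noteq> 0" "qpoch (-q) q \<noteq> 0"
  proof -
    show "qpoch (-q) q \<noteq> 0"
      using assms by (intro qpoch_nonzero_disk) auto
    thus "qpoch (-1) q \<noteq> 0"
      using qpoch_Suc[OF assms(1), of "-1"] by simp
  qed
  define T where "T = (\<Sum>\<^sub>\<infinity>n\<in>charge_vectors p. q powi weight p n)"
  have T: "((\<lambda>n. q powi weight p n) has_sum T) (charge_vectors p)"
    unfolding T_def by (rule has_sum_infsum[OF abs_summable_summable[OF abs_summable_weight[OF assms]]])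
  have "T = (\<Prod>i<p. theta (q ^ p) (q ^ i))"
  proof -
    have "T = (\<Sum>\<^sub>\<infinity>n\<in>PiE {..<p} (\<lambda>_. UNIV). \<Prod>i<p. theta_term (q ^ p) (q ^ i) (n i))"
      using assms by (simp add: T_def charge_vectors_def prod_theta_terms)
    also have "\<dots> = (\<Prod>i<p. theta (q ^ p) (q ^ i))"
      unfolding theta_def using assms qp
      by (intro infsum_prod_PiE_abs abs_summable_theta) auto
    finally show ?thesis .
  qed
  also have "\<dots> = (\<Prod>i<p. euler_prod (q ^ p) * qpoch ((-1) * q ^ i) (q ^ p) * qpoch ((-q) * q ^ (p - Suc i)) (q ^ p))"
  proof (rule prod.cong)
    fix i assume i: "i \<in> {..<p}"
    have "q ^ p = q * q ^ (p - Suc i) * q ^ i"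
      using i by (simp add: mult.assoc flip: power_add power_Suc)
    hence "- (q ^ p) / q ^ i = (-q) * q ^ (p - Suc i)"
      using assms by (simp add: field_simps)
    thus "theta (q ^ p) (q ^ i) =
        euler_prod (q ^ p) * qpoch ((-1) * q ^ i) (q ^ p) * qpoch ((-q) * q ^ (p - Suc i)) (q ^ p)"
      using jacobi_triple_product[OF qp, of "q ^ i"] assms by simp
  qed simp
  also have "\<dots> = euler_prod (q ^ p) ^ p * (\<Prod>i<p. qpoch ((-1) * q ^ i) (q ^ p)) *
      (\<Prod>i<p. qpoch ((-q) * q ^ (p - Suc i)) (q ^ p))"
    by (simp add: prod.distrib)
  also have "(\<Prod>i<p. qpoch ((-q) * q ^ (p - Suc i)) (q ^ p)) = (\<Prod>i<p. qpoch ((-q) * q ^ i) (q ^ p))"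
    by (rule prod.nat_diff_reindex)
  finally have T1: "T = euler_prod (q ^ p) ^ p * qpoch (-1) q * qpoch (-q) q"
    by (simp only: qpoch_multisection[OF assms(1,3)])
  have "T = layer_sum p q 0 * theta q 1"
  proof -
    have "bij_betw snd (Sigma UNIV (layer p)) (charge_vectors p)"
      by (rule bij_betwI[where g = "\<lambda>n. (charge p n, n)"]) (auto simp: layer_def)
    from T[folded has_sum_reindex_bij_betw[OF this]]
    have "((\<lambda>x. q powi weight p (snd x)) has_sum T) (Sigma UNIV (layer p))" .
    hence "(layer_sum p q has_sum T) UNIV"
      by (rule has_sum_SigmaD) (use has_sum_layer[OF assms] in simp)
    moreover have "((\<lambda>s. theta_term q 1 s * layer_sum p q 0) has_sum (theta q 1 * layer_sum p q 0)) UNIV"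
      using assms by (intro has_sum_cmult_left has_sum_theta) auto
    hence "(layer_sum p q has_sum (theta q 1 * layer_sum p q 0)) UNIV"
      unfolding layer_sum_eq[OF assms, symmetric] .
    ultimately have "T = theta q 1 * layer_sum p q 0"
      by (rule has_sum_unique)
    thus ?thesis
      by (simp only: mult.commute)
  qed
  also have "theta q 1 = euler_prod q * qpoch (-1) q * qpoch (-q) q"
    using jacobi_triple_product[OF assms(1,2), of 1] by simp
  finally have "layer_sum p q 0 * euler_prod q * (qpoch (-1) q * qpoch (-q) q) =
      euler_prod (q ^ p) ^ p * (qpoch (-1) q * qpoch (-q) q)"
    using T1 by (auto simp: mult_ac)
  thus ?thesis
    using nz E by (simp add: field_simps)
qed

section \<open>The two-variable core identity\<close>

text \<open>The two-variable refinement of the core series: in each vector one of the \<open>p\<close> beads is marked, and \<open>z\<close>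
  records its position.\<close>

definition marked :: "nat \<Rightarrow> ((nat \<Rightarrow> int) \<times> nat) set" where
  "marked p = layer p 0 \<times> {..<p}"

definition position :: "nat \<Rightarrow> (nat \<Rightarrow> int) \<times> nat \<Rightarrow> int" where
  "position p = (\<lambda>(n, j). int p * n j + int j)"

text \<open>All beads move one step down, and then the marked bead moves up by a full row. The coordinate sum
  remains \<open>0\<close>, the marked position rises by \<open>p - 1\<close> and the weight rises by the old marked position; this
  encodes the functional equation of \<open>mark_sum\<close> under \<open>z \<mapsto> q z\<close>.\<close>

definition rotate_mark :: "nat \<Rightarrow> (nat \<Rightarrow> int) \<times> nat \<Rightarrow> (nat \<Rightarrow> int) \<times> nat" where
  "rotate_mark p = (\<lambda>(n, j). let i = (if j = 0 then p - 1 else j - 1); m = shift p n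
                    in (m(i := m i + 1), i))"

text \<open>The sum is the weight of the vector in which the marked coordinate is increased by one.\<close>

lemma weight_position_nonneg:
  assumes "x \<in> marked p"
  shows "weight p (fst x) + position p x \<ge> 0"
  using assms weight_nonneg[of p "(fst x)(snd x := fst x (snd x) + 1)"]
  by (cases x) (auto simp: marked_def position_def weight_incr)

lemma rotate_mark:
  assumes "x \<in> marked p"
  shows "rotate_mark p x \<in> marked p"
    and "weight p (fst (rotate_mark p x)) = weight p (fst x) + position p x"
    and "position p (rotate_mark p x) = position p x + int p - 1"
proof -
  obtain n j where x: "x = (n, j)" "n \<in> layer p 0" "j < p"
    using assms by (auto simp: marked_def)
  have fst_x: "fst x = n"
    by (simp add: x)
  define i where "i = (if j = 0 then p - 1 else j - 1)"
  have i: "i < p" "p > 0"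
    using x by (auto simp: i_def)
  define m where "m = shift p n"
  have rot: "rotate_mark p x = (m(i := m i + 1), i)"
    by (simp add: rotate_mark_def x i_def m_def Let_def)
  have mi: "int p * m i + int i + 1 = position p x"
    using x by (auto simp: m_def i_def shift_def position_def algebra_simps of_nat_diff)
  have "charge p m = - 1" "weight p m = weight p n + 1"
    using x charge_shift[OF i(2), of n] weight_shift[OF i(2), of n] by (simp_all add: layer_def m_def)
  moreover have "m \<in> charge_vectors p"
    by (simp add: m_def shift_charge_vectors)
  ultimately show "rotate_mark p x \<in> marked p"
    "weight p (fst (rotate_mark p x)) = weight p (fst x) + position p x"
    using i mi charge_upd[OF i(1), of m] weight_incr[OF i(1), of m] upd_charge_vectors[of m p i]
    by (auto simp: rot marked_def layer_def fst_x)
  show "position p (rotate_mark p x) = position p x + int p - 1"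
    using mi by (simp add: rot position_def algebra_simps)
qed

lemma bij_betw_rotate_mark: "bij_betw (rotate_mark p) (marked p) (marked p)"
proof (rule bij_betwI[where g = "\<lambda>(n, i). (unshift p (n(i := n i - 1)), if Suc i = p then 0 else Suc i)"])
  show "rotate_mark p \<in> marked p \<rightarrow> marked p"
    using rotate_mark by blast
  show "(\<lambda>(n, i). (unshift p (n(i := n i - 1)), if Suc i = p then 0 else Suc i)) \<in> marked p \<rightarrow> marked p"
  proof safe
    fix n i assume ni: "(n, i) \<in> marked p"
    define m where "m = n(i := n i - 1)"
    have p: "p > 0" "i < p"
      using ni by (auto simp: marked_def)
    have "m \<in> layer p (0 - 1)"
      using ni charge_upd[OF p(2), of n "n i - 1"] upd_charge_vectors[of n p i "n i - 1"] p
      by (auto simp: marked_def layer_def m_def)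
    hence "unshift p m \<in> layer p 0"
      using charge_shift[OF p(1), of "unshift p m"] shift_unshift[of m p] unshift_charge_vectors[of p m]
      by (auto simp: layer_def)
    thus "(unshift p (n(i := n i - 1)), if Suc i = p then 0 else Suc i) \<in> marked p"
      using p by (auto simp: marked_def m_def)
  qed
next
  fix x assume "x \<in> marked p"
  thus "(case rotate_mark p x of (n, i) \<Rightarrow> (unshift p (n(i := n i - 1)), if Suc i = p then 0 else Suc i)) = x"
    using unshift_shift[of "fst x" p]
    by (auto simp: rotate_mark_def marked_def layer_def Let_def split: prod.splits if_splits)
next
  fix x assume x: "x \<in> marked p"
  obtain n i where ni: "x = (n, i)"
    by (cases x)
  have "n(i := n i - 1) \<in> charge_vectors p"
    using x ni upd_charge_vectors[of n p i] by (auto simp: marked_def layer_def)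
  thus "rotate_mark p (case x of (n, i) \<Rightarrow> (unshift p (n(i := n i - 1)), if Suc i = p then 0 else Suc i)) = x"
    using x by (auto simp: ni rotate_mark_def marked_def layer_def Let_def shift_unshift)
qed

definition mark_term :: "nat \<Rightarrow> complex \<Rightarrow> complex \<Rightarrow> (nat \<Rightarrow> int) \<times> nat \<Rightarrow> complex" where
  "mark_term p q z x = q powi weight p (fst x) * z powi position p x"

definition mark_sum :: "nat \<Rightarrow> complex \<Rightarrow> complex \<Rightarrow> complex" where
  "mark_sum p q z = (\<Sum>\<^sub>\<infinity>x\<in>marked p. mark_term p q z x)"

lemma abs_summable_mark_term:
  assumes "norm q < 1" "q \<noteq> 0" "p > 0" "z \<noteq> 0"
  shows "(\<lambda>x. norm (mark_term p q z x)) summable_on marked p"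
proof -
  have qp: "norm (q ^ p) < 1" "q ^ p \<noteq> 0"
    using assms norm_power_less_one by auto
  have "(\<lambda>x. norm (mark_term p q z x)) summable_on (charge_vectors p \<times> {..<p})"
  proof (subst summable_on_swap, rule summable_on_SigmaI)
    fix j assume j: "j \<in> {..<p}"
    define f where "f = (\<lambda>i. theta_term (q ^ p) (if i = j then q ^ i * z ^ p else q ^ i))"
    have "(\<lambda>n. norm (\<Prod>i<p. f i (n i))) summable_on charge_vectors p"
      unfolding charge_vectors_def f_def using assms qp
      by (intro abs_summable_prod_PiE abs_summable_theta) auto
    hence "(\<lambda>n. norm (\<Prod>i<p. f i (n i)) * norm (z ^ j)) summable_on charge_vectors p"
      by (rule summable_on_cmult_left)
    also have "(\<lambda>n. norm (\<Prod>i<p. f i (n i)) * norm (z ^ j)) = (\<lambda>n. norm (mark_term p q z (n, j)))"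
    proof
      fix n
      have "(\<Prod>i<p. f i (n i)) = (\<Prod>i<p. theta_term (q ^ p) (q ^ i) (n i) * (if i = j then (z ^ p) powi n i else 1))"
        by (intro prod.cong) (auto simp: f_def theta_term_def power_int_mult_distrib)
      also have "\<dots> = q powi weight p n * (z ^ p) powi n j"
        using j by (simp add: prod.distrib prod_theta_terms[OF assms(2)])
      finally show "norm (\<Prod>i<p. f i (n i)) * norm (z ^ j) = norm (mark_term p q z (n, j))"
        using assms by (simp add: mark_term_def position_def norm_mult power_int_add power_int_mult)
    qed
    finally show "((\<lambda>n. case (j, n) of (x, y) \<Rightarrow> norm (mark_term p q z (y, x))) has_sum
        (\<Sum>\<^sub>\<infinity>n\<in>charge_vectors p. norm (mark_term p q z (n, j)))) (charge_vectors p)"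
      by simp
  qed auto
  thus ?thesis
    by (rule summable_on_subset_banach) (auto simp: marked_def layer_def)
qed

lemma has_sum_mark_sum:
  assumes "norm q < 1" "q \<noteq> 0" "p > 0" "z \<noteq> 0"
  shows "(mark_term p q z has_sum mark_sum p q z) (marked p)"
  unfolding mark_sum_def
  by (rule has_sum_infsum[OF abs_summable_summable[OF abs_summable_mark_term[OF assms]]])

lemma mark_sum_1:
  assumes "norm q < 1" "q \<noteq> 0" "p > 0"
  shows "mark_sum p q 1 = of_nat p * layer_sum p q 0"
proof -
  have "((\<lambda>n. \<Sum>j<p. mark_term p q 1 (n, j)) has_sum mark_sum p q 1) (layer p 0)"
    using has_sum_mark_sum[OF assms, of 1] unfolding marked_def
    by (rule has_sum_SigmaD) auto
  moreover have "((\<lambda>n. \<Sum>j<p. mark_term p q 1 (n, j)) has_sum of_nat p * layer_sum p q 0) (layer p 0)"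
    using has_sum_cmult_right[OF has_sum_layer[OF assms, of 0], of "of_nat p"] by (simp add: mark_term_def)
  ultimately show ?thesis
    by (rule has_sum_unique)
qed

text \<open>The coefficient of \<open>z powi k\<close> in the product of \<open>mark_sum p q z\<close> and \<open>theta q (- z)\<close>.\<close>

definition mark_coeff :: "nat \<Rightarrow> complex \<Rightarrow> int \<Rightarrow> complex" where
  "mark_coeff p q k = (\<Sum>\<^sub>\<infinity>x\<in>marked p. q powi weight p (fst x) * theta_term q (-1) (k - position p x))"

lemma mark_sum_times_theta:
  assumes "norm q < 1" "q \<noteq> 0" "p > 0" "z \<noteq> 0"
  shows "(\<lambda>(x, k). norm (q powi weight p (fst x) * theta_term q (-1) (k - position p x) * z powi k))
            summable_on (marked p \<times> UNIV)" (is ?th1)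
    and "((\<lambda>k. mark_coeff p q k * z powi k) has_sum (mark_sum p q z * theta q (- z))) UNIV" (is ?th2)
proof -
  define F where "F = (\<lambda>(x, k). q powi weight p (fst x) * theta_term q (-1) (k - position p x) * z powi k)"
  have bij: "bij_betw (\<lambda>(x, m). (x, m + position p x)) (marked p \<times> UNIV) (marked p \<times> UNIV)"
    by (rule bij_betwI[where g = "\<lambda>(x, k). (x, k - position p x)"]) auto
  have F: "F (case y of (x, m) \<Rightarrow> (x, m + position p x)) = (case y of (x, m) \<Rightarrow> mark_term p q z x * theta_term q (- z) m)" for y
  proof -
    have "theta_term q (-1) m * z powi m = theta_term q (- z) m" for m
      by (simp add: theta_term_def flip: power_int_mult_distrib)
    thus ?thesis
      using assms by (cases y) (simp add: F_def mark_term_def power_int_add mult_ac)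
  qed
  have "(\<lambda>(x, m). norm (mark_term p q z x * theta_term q (- z) m)) summable_on (marked p \<times> UNIV)"
    using assms by (intro abs_summable_times abs_summable_mark_term abs_summable_theta) auto
  hence sum1: "(\<lambda>y. norm (case y of (x, m) \<Rightarrow> mark_term p q z x * theta_term q (- z) m)) summable_on (marked p \<times> UNIV)"
    by (simp add: case_prod_unfold)
  hence sum2: "(\<lambda>y. norm (F y)) summable_on (marked p \<times> UNIV)"
    unfolding F[symmetric] using summable_on_reindex_bij_betw[OF bij, of "\<lambda>y. norm (F y)"] by simp
  thus ?th1
    by (simp add: F_def case_prod_unfold)
  have "((\<lambda>(x, m). mark_term p q z x * theta_term q (- z) m) has_sum (mark_sum p q z * theta q (- z))) (marked p \<times> UNIV)"
  proof (rule has_sum_SigmaI)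
    fix x assume "x \<in> marked p"
    show "((\<lambda>y. case (x, y) of (x, m) \<Rightarrow> mark_term p q z x * theta_term q (- z) m) has_sum
            (mark_term p q z x * theta q (- z))) UNIV"
      using assms by (auto intro!: has_sum_cmult_right has_sum_theta)
  next
    show "((\<lambda>x. mark_term p q z x * theta q (- z)) has_sum (mark_sum p q z * theta q (- z))) (marked p)"
      using assms by (intro has_sum_cmult_left has_sum_mark_sum)
  next
    show "(\<lambda>(x, m). mark_term p q z x * theta_term q (- z) m) summable_on marked p \<times> UNIV"
      using abs_summable_summable[OF sum1] by simp
  qed
  also have "(\<lambda>(x, m). mark_term p q z x * theta_term q (- z) m) = (\<lambda>y. F (case y of (x, m) \<Rightarrow> (x, m + position p x)))"
    by (rule ext, rule F [symmetric])
  finally have "(F has_sum (mark_sum p q z * theta q (- z))) (marked p \<times> UNIV)"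
    unfolding has_sum_reindex_bij_betw[OF bij] .
  hence G: "((\<lambda>(k, x). F (x, k)) has_sum (mark_sum p q z * theta q (- z))) (UNIV \<times> marked p)"
    by (subst (asm) has_sum_swap)
  thus ?th2
  proof (rule has_sum_SigmaD)
    fix k :: int
    have "(\<lambda>x. F (x, k)) summable_on marked p"
      using summable_on_SigmaD1[OF has_sum_imp_summable[OF G], of k] by simp
    hence "(\<lambda>x. F (x, k)) summable_on marked p"
      by simp
    hence "((\<lambda>x. F (x, k)) has_sum (\<Sum>\<^sub>\<infinity>x\<in>marked p. F (x, k))) (marked p)"
      by (rule has_sum_infsum)
    also have "(\<Sum>\<^sub>\<infinity>x\<in>marked p. F (x, k)) = mark_coeff p q k * z powi k"
      unfolding mark_coeff_def F_def by (simp add: infsum_cmult_left')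
    finally show "((\<lambda>y. case (k, y) of (k, x) \<Rightarrow> F (x, k)) has_sum mark_coeff p q k * z powi k) (marked p)"
      by simp
  qed
qed

lemma mark_coeff_step:
  assumes "norm q < 1" "q \<noteq> 0" "p > 0"
  shows "mark_coeff p q (k + int p) = - (q powi k) * mark_coeff p q k"
proof -
  have "mark_coeff p q (k + int p) = (\<Sum>\<^sub>\<infinity>x\<in>marked p. q powi weight p (fst (rotate_mark p x)) *
            theta_term q (-1) (k + int p - position p (rotate_mark p x)))"
    unfolding mark_coeff_def by (rule infsum_reindex_bij_betw[OF bij_betw_rotate_mark, symmetric])
  also have "\<dots> = (\<Sum>\<^sub>\<infinity>x\<in>marked p. - (q powi k) * (q powi weight p (fst x) * theta_term q (-1) (k - position p x)))"
  proof (rule infsum_cong)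
    fix x assume x: "x \<in> marked p"
    have "k + int p - position p (rotate_mark p x) = (k - position p x) + 1"
      by (simp add: rotate_mark[OF x])
    hence "theta_term q (-1) (k + int p - position p (rotate_mark p x)) = theta_term q (-1) ((k - position p x) + 1)"
      by (simp only:)
    also have "\<dots> = - (q powi (k - position p x)) * theta_term q (-1) (k - position p x)"
      using assms by (subst theta_term_add_1) auto
    finally show "q powi weight p (fst (rotate_mark p x)) * theta_term q (-1) (k + int p - position p (rotate_mark p x)) =
        - (q powi k) * (q powi weight p (fst x) * theta_term q (-1) (k - position p x))"
      using assms by (simp add: rotate_mark[OF x] power_int_add power_int_diff)
  qed
  also have "\<dots> = - (q powi k) * mark_coeff p q k"
    unfolding mark_coeff_def by (rule infsum_cmult_right')
  finally show ?thesis .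
qed

lemma mark_coeff_progression:
  assumes "norm q < 1" "q \<noteq> 0" "p > 0"
  shows "mark_coeff p q (int r + int p * i) = mark_coeff p q (int r) * theta_term (q ^ p) (- (q ^ r)) i"
proof (induction i rule: int_induct[where k = 0])
  case base
  show ?case by (simp add: theta_term_def)
next
  case (step1 i)
  have "mark_coeff p q (int r + int p * (i + 1)) = - (q powi (int r + int p * i)) * mark_coeff p q (int r + int p * i)"
    using mark_coeff_step[OF assms, of "int r + int p * i"] by (simp add: algebra_simps)
  also have "\<dots> = mark_coeff p q (int r) * theta_term (q ^ p) (- (q ^ r)) (i + 1)"
    using step1 assms theta_term_add_1[of "q ^ p" "- (q ^ r)" i]
    by (simp add: power_int_add power_int_mult)
  finally show ?case .
next
  case (step2 i)
  have "- (q powi (int r + int p * (i - 1))) * mark_coeff p q (int r + int p * (i - 1)) = mark_coeff p q (int r + int p * i)"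
    using mark_coeff_step[OF assms, of "int r + int p * (i - 1)"] by (simp add: algebra_simps)
  also have "\<dots> = - (q powi (int r + int p * (i - 1))) * (mark_coeff p q (int r) * theta_term (q ^ p) (- (q ^ r)) (i - 1))"
    using step2 assms theta_term_add_1[of "q ^ p" "- (q ^ r)" "i - 1"]
    by (simp add: power_int_add power_int_mult)
  finally show ?case
    using assms by simp
qed

lemma qpoch_1 [simp]: "norm q < 1 \<Longrightarrow> qpoch 1 q = 0"
  by (subst qpoch_Suc) auto

lemma theta_minus_1:
  assumes "norm q < 1" "q \<noteq> 0"
  shows "theta q (-1) = 0"
  using jacobi_triple_product[OF assms, of "-1"] assms by simp

text \<open>For a fixed vector \<open>n\<close>, the numbers \<open>r + p i - (p (n j) + j)\<close> run through every integer exactly once as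
  \<open>j < p\<close> and \<open>i\<close> vary. Hence each vector contributes a multiple of \<open>theta q (-1)\<close>, which vanishes.\<close>

lemma mark_coeff_sum_progression:
  assumes "norm q < 1" "q \<noteq> 0" "p > 0"
  shows "((\<lambda>i. mark_coeff p q (int r + int p * i)) has_sum 0) UNIV"
proof -
  define F where "F = (\<lambda>(x, k). q powi weight p (fst x) * theta_term q (-1) (k - position p x))"
  define H where "H = (\<lambda>(n, j, i). F ((n, j), int r + int p * i))"
  have "(\<lambda>y. norm (F y)) summable_on (marked p \<times> UNIV)"
    using mark_sum_times_theta(1)[OF assms, of 1] by (simp add: F_def case_prod_unfold)
  hence F: "F summable_on (marked p \<times> UNIV)"
    by (rule abs_summable_summable)
  define h where "h = (\<lambda>(n::nat \<Rightarrow> int, j::nat, i). ((n, j), int r + int p * i))"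
  have inj: "inj_on h (layer p 0 \<times> {..<p} \<times> UNIV)"
    using assms by (auto simp: inj_on_def h_def)
  have "F summable_on h ` (layer p 0 \<times> {..<p} \<times> UNIV)"
    by (rule summable_on_subset_banach[OF F]) (auto simp: h_def marked_def)
  hence "(F \<circ> h) summable_on (layer p 0 \<times> {..<p} \<times> UNIV)"
    by (subst (asm) summable_on_reindex[OF inj])
  also have "F \<circ> h = H"
    by (auto simp: H_def h_def fun_eq_iff)
  finally have H: "H summable_on (layer p 0 \<times> {..<p} \<times> UNIV)" .
  have "(H has_sum 0) (layer p 0 \<times> {..<p} \<times> UNIV)"
  proof (rule has_sum_SigmaI[OF _ _ H])
    fix n assume "n \<in> layer p 0"
    define g where "g = (\<lambda>(j, i). int r + int p * (i - n j) - int j)"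
    have bij: "bij_betw g ({..<p} \<times> UNIV) UNIV"
    proof (rule bij_betwI[where g = "\<lambda>k. (nat ((int r - k) mod int p),
        n (nat ((int r - k) mod int p)) - (int r - k) div int p)"])
      show "(\<lambda>k. (nat ((int r - k) mod int p), n (nat ((int r - k) mod int p)) - (int r - k) div int p))
          \<in> UNIV \<rightarrow> {..<p} \<times> UNIV"
        using assms by (auto simp: nat_less_iff)
    next
      fix y :: "nat \<times> int" assume "y \<in> {..<p} \<times> UNIV"
      then obtain j i where y: "y = (j, i)" "j < p"
        by auto
      have eq: "int r - g y = int j + int p * (n j - i)"
        by (simp add: g_def y algebra_simps)
      have "(int r - g y) mod int p = int j" "(int r - g y) div int p = n j - i"
        unfolding eq using y by auto
      thus "(nat ((int r - g y) mod int p), n (nat ((int r - g y) mod int p)) - (int r - g y) div int p) = y"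
        by (simp add: y)
    next
      fix k :: int
      have "int p * ((int r - k) div int p) + (int r - k) mod int p = int r - k"
        by simp
      moreover have "(int r - k) mod int p \<ge> 0"
        using assms by simp
      ultimately show "g (nat ((int r - k) mod int p), n (nat ((int r - k) mod int p)) - (int r - k) div int p) = k"
        by (simp add: g_def algebra_simps)
    qed simp
    have "((\<lambda>k. q powi weight p n * theta_term q (-1) k) has_sum (q powi weight p n * 0)) UNIV"
      using has_sum_theta[OF assms(1,2), of "-1"] theta_minus_1[OF assms(1,2)]
      by (intro has_sum_cmult_right) simp
    hence "((\<lambda>y. q powi weight p n * theta_term q (-1) (g y)) has_sum (q powi weight p n * 0)) ({..<p} \<times> UNIV)"
      by (subst has_sum_reindex_bij_betw[OF bij, of "\<lambda>k. q powi weight p n * theta_term q (-1) k"])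
    also have "(\<lambda>y. q powi weight p n * theta_term q (-1) (g y)) = (\<lambda>y. H (n, y))"
      by (auto simp: H_def F_def g_def position_def fun_eq_iff algebra_simps)
    finally show "((\<lambda>y. H (n, y)) has_sum 0) ({..<p} \<times> UNIV)"
      by simp
  qed simp
  hence "(F has_sum 0) (h ` (layer p 0 \<times> {..<p} \<times> UNIV))"
    unfolding \<open>F \<circ> h = H\<close>[symmetric] by (subst has_sum_reindex[OF inj])
  also have "h ` (layer p 0 \<times> {..<p} \<times> UNIV) = (\<lambda>(x, i). (x, int r + int p * i)) ` (marked p \<times> UNIV)"
    by (auto simp: h_def marked_def image_iff)
  also have "(F has_sum 0) \<dots> \<longleftrightarrow> ((F \<circ> (\<lambda>(x, i). (x, int r + int p * i))) has_sum 0) (marked p \<times> UNIV)"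
    using assms by (intro has_sum_reindex) (auto simp: inj_on_def)
  also have "F \<circ> (\<lambda>(x, i). (x, int r + int p * i)) = (\<lambda>(x, i). F (x, int r + int p * i))"
    by (auto simp: fun_eq_iff)
  finally have G: "((\<lambda>(i, x). F (x, int r + int p * i)) has_sum 0) (UNIV \<times> marked p)"
    by (subst (asm) has_sum_swap) simp
  thus ?thesis
  proof (rule has_sum_SigmaD)
    fix i :: int
    have "(\<lambda>x. F (x, int r + int p * i)) summable_on marked p"
      using summable_on_SigmaD1[OF has_sum_imp_summable[OF G], of i] by simp
    from has_sum_infsum[OF this]
    show "((\<lambda>y. case (i, y) of (i, x) \<Rightarrow> F (x, int r + int p * i)) has_sum mark_coeff p q (int r + int p * i)) (marked p)"
      by (simp add: F_def mark_coeff_def)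
  qed
qed

text \<open>By \<open>mark_coeff_progression\<close> the vanishing sum over the residue class of \<open>r\<close> is the coefficient at \<open>r\<close>
  times a theta value, and the triple product shows that this value is zero only if \<open>p\<close> divides \<open>r\<close>.\<close>

lemma mark_coeff_eq_0:
  assumes "norm q < 1" "q \<noteq> 0" "0 < r" "r < p"
  shows "mark_coeff p q (int r) = 0"
proof -
  have p: "p > 0"
    using assms by simp
  have qp: "norm (q ^ p) < 1" "q ^ p \<noteq> 0"
    using assms norm_power_less_one by auto
  have "((\<lambda>i. mark_coeff p q (int r) * theta_term (q ^ p) (- (q ^ r)) i) has_sum
          mark_coeff p q (int r) * theta (q ^ p) (- (q ^ r))) UNIV"
    using assms qp by (intro has_sum_cmult_right has_sum_theta) auto
  moreover have "((\<lambda>i. mark_coeff p q (int r) * theta_term (q ^ p) (- (q ^ r)) i) has_sum 0) UNIV"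
    using mark_coeff_sum_progression[OF assms(1,2) p, of r]
    unfolding mark_coeff_progression[OF assms(1,2) p] .
  ultimately have "mark_coeff p q (int r) * theta (q ^ p) (- (q ^ r)) = 0"
    by (rule has_sum_unique)
  moreover have "theta (q ^ p) (- (q ^ r)) \<noteq> 0"
  proof -
    have "q ^ p = q ^ (p - r) * q ^ r"
      using assms by (simp flip: power_add)
    hence "- (q ^ p) / - (q ^ r) = q ^ (p - r)"
      using assms by (simp add: field_simps)
    hence "theta (q ^ p) (- (q ^ r)) = euler_prod (q ^ p) * qpoch (q ^ r) (q ^ p) * qpoch (q ^ (p - r)) (q ^ p)"
      using jacobi_triple_product[OF qp, of "- (q ^ r)"] assms by simp
    moreover have "norm (q ^ r) < 1" "norm (q ^ (p - r)) < 1"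
      using assms by (intro norm_power_less_one; simp)+
    ultimately show ?thesis
      using qp qpoch_nonzero_disk by simp
  qed
  ultimately show ?thesis
    by simp
qed

lemma mark_sum_times_theta_eq:
  assumes "norm q < 1" "q \<noteq> 0" "p > 0" "z \<noteq> 0"
  shows "mark_sum p q z * theta q (- z) = mark_coeff p q 0 * theta (q ^ p) (- (z ^ p))"
proof -
  have qp: "norm (q ^ p) < 1" "q ^ p \<noteq> 0"
    using assms norm_power_less_one by auto
  have inj: "inj (\<lambda>i::int. int p * i)"
    using assms by (auto simp: inj_on_def)
  have zero: "mark_coeff p q k = 0" if "k \<notin> range (\<lambda>i. int p * i)" for k
  proof -
    define r where "r = nat (k mod int p)"
    have r: "int r = k mod int p"
      using assms by (simp add: r_def)
    have "\<not> int p dvd k"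
      using that by (auto simp: dvd_def)
    hence "0 < r" "r < p"
      using assms r by (auto simp: r_def nat_less_iff dvd_eq_mod_eq_0 zero_less_nat_eq
          intro: order_le_neq_trans)
    moreover have "k = int r + int p * (k div int p)"
      by (simp add: r)
    ultimately show ?thesis
      using mark_coeff_progression[OF assms(1-3), of r "k div int p"] mark_coeff_eq_0[OF assms(1,2), of r p]
      by simp
  qed
  have "((\<lambda>k. mark_coeff p q k * z powi k) has_sum (mark_sum p q z * theta q (- z))) UNIV"
    by (rule mark_sum_times_theta(2)[OF assms])
  also have "?this \<longleftrightarrow> ((\<lambda>k. mark_coeff p q k * z powi k) has_sum (mark_sum p q z * theta q (- z))) (range (\<lambda>i. int p * i))"
    by (rule has_sum_cong_neutral) (use zero in auto)
  also have "\<dots> \<longleftrightarrow> (((\<lambda>k. mark_coeff p q k * z powi k) \<circ> (\<lambda>i. int p * i)) has_sum (mark_sum p q z * theta q (- z))) UNIV"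
    by (rule has_sum_reindex[OF inj])
  also have "((\<lambda>k. mark_coeff p q k * z powi k) \<circ> (\<lambda>i. int p * i)) =
      (\<lambda>i. mark_coeff p q 0 * theta_term (q ^ p) (- (z ^ p)) i)"
  proof
    fix i
    have "mark_coeff p q (int p * i) = mark_coeff p q 0 * theta_term (q ^ p) (- 1) i"
      using mark_coeff_progression[OF assms(1-3), of 0 i] by simp
    moreover have "theta_term (q ^ p) (- (z ^ p)) i = theta_term (q ^ p) (- 1) i * z powi (int p * i)"
      using power_int_mult_distrib[of "-1" "z ^ p" i] by (simp add: theta_term_def power_int_mult)
    ultimately show "((\<lambda>k. mark_coeff p q k * z powi k) \<circ> (\<lambda>i. int p * i)) i =
        mark_coeff p q 0 * theta_term (q ^ p) (- (z ^ p)) i"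
      by simp
  qed
  finally have "((\<lambda>i. mark_coeff p q 0 * theta_term (q ^ p) (- (z ^ p)) i) has_sum mark_sum p q z * theta q (- z)) UNIV" .
  moreover have "((\<lambda>i. mark_coeff p q 0 * theta_term (q ^ p) (- (z ^ p)) i) has_sum
      mark_coeff p q 0 * theta (q ^ p) (- (z ^ p))) UNIV"
    using assms qp by (intro has_sum_cmult_right has_sum_theta) auto
  ultimately show ?thesis
    by (rule has_sum_unique)
qed

lemma isCont_qpoch:
  fixes q :: complex
  assumes "norm q < 1"
  shows "isCont (\<lambda>a. qpoch a q) a"
proof -
  define A where "A = cball (0::complex) (norm a + 1)"
  have "uniformly_convergent_on A (\<lambda>N x. \<Sum>n<N. norm ((1 - x * q ^ n) - 1))"
  proof (rule Weierstrass_m_test')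
    show "summable (\<lambda>n. (norm a + 1) * norm q ^ n)"
      using assms by (intro summable_mult summable_geometric) auto
    show "norm (norm ((1 - x * q ^ n) - 1)) \<le> (norm a + 1) * norm q ^ n" if "x \<in> A" for n x
      using that by (auto simp: A_def norm_mult norm_power intro!: mult_right_mono)
  qed
  hence "uniformly_convergent_on A (\<lambda>N x. \<Prod>n<N. 1 - x * q ^ n)"
    by (intro uniformly_convergent_on_prod') (auto simp: A_def intro!: continuous_intros)
  then obtain l where l: "uniform_limit A (\<lambda>N x. \<Prod>n<N. 1 - x * q ^ n) l sequentially"
    by (auto simp: uniformly_convergent_on_def)
  have "continuous_on A l"
    by (rule uniform_limit_theorem[OF _ l]) (auto intro!: always_eventually continuous_intros)
  also have "?this \<longleftrightarrow> continuous_on A (\<lambda>a. qpoch a q)"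
  proof (rule continuous_on_cong)
    fix x assume "x \<in> A"
    show "l x = qpoch x q"
      using LIMSEQ_unique[OF tendsto_uniform_limitI[OF l \<open>x \<in> A\<close>] qpoch_LIMSEQ[OF assms]] .
  qed simp
  finally show ?thesis
    by (rule continuous_on_interior) (simp add: A_def)
qed

lemma tendsto_qpoch [tendsto_intros]:
  assumes "(f \<longlongrightarrow> a) F" "norm q < 1"
  shows "((\<lambda>x. qpoch (f x) q) \<longlongrightarrow> qpoch a q) F"
  using isCont_tendsto_compose[OF isCont_qpoch[OF assms(2)] assms(1)] .

text \<open>For \<open>1/2 < |z| < 2\<close> every term is dominated by the sum of the terms at \<open>2\<close> and \<open>1/2\<close>.\<close>

lemma tendsto_mark_sum_1:
  assumes "norm q < 1" "q \<noteq> 0" "p > 0"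
  shows "(mark_sum p q \<longlongrightarrow> mark_sum p q 1) (at 1)"
  unfolding mark_sum_def
proof (rule tendsto_infsum_dominated)
  show "(\<lambda>x. norm (mark_term p q 2 x) + norm (mark_term p q (1 / 2) x)) summable_on marked p"
    using assms by (intro summable_on_add abs_summable_mark_term) auto
  show "((\<lambda>z. mark_term p q z x) \<longlongrightarrow> mark_term p q 1 x) (at 1)" for x
    unfolding mark_term_def by (intro tendsto_intros) auto
  have "\<forall>\<^sub>F z in at (1::complex). norm z < 2" "\<forall>\<^sub>F z in at (1::complex). norm z > 1 / 2"
    by (rule order_tendstoD[of norm "norm (1::complex)"]; (intro tendsto_intros)?; simp)+
  thus "\<forall>\<^sub>F z in at (1::complex). \<forall>x\<in>marked p. norm (mark_term p q z x) \<le>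
      norm (mark_term p q 2 x) + norm (mark_term p q (1 / 2) x)"
  proof eventually_elim
    case (elim z)
    have bound: "norm z powi l \<le> 2 powi l + (1 / 2) powi l" for l :: int
    proof (cases "l \<ge> 0")
      case True
      hence "norm z powi l \<le> 2 powi l"
        using elim by (intro power_int_mono) auto
      thus ?thesis
        by (simp add: add_increasing2)
    next
      case False
      hence "norm z powi l \<le> (1 / 2) powi l"
        using elim by (intro power_int_antimono) auto
      thus ?thesis
        by (simp add: add_increasing)
    qed
    show ?case
    proof
      fix x
      have "norm (mark_term p q z x) \<le> norm (q powi weight p (fst x)) * (2 powi position p x + (1 / 2) powi position p x)"
        using bound by (auto simp: mark_term_def norm_mult norm_power_int intro!: mult_left_mono)
      also have "\<dots> = norm (mark_term p q 2 x) + norm (mark_term p q (1 / 2) x)"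
        by (simp add: mark_term_def norm_mult norm_power_int norm_divide distrib_left)
      finally show "norm (mark_term p q z x) \<le> norm (mark_term p q 2 x) + norm (mark_term p q (1 / 2) x)" .
    qed
  qed
qed

text \<open>At \<open>z = 1\<close> both sides of \<open>mark_sum_times_theta_eq\<close> vanish to first order. Dividing by \<open>1 - z\<close> and letting
  \<open>z\<close> tend to \<open>1\<close> compares the leading coefficients; the factor \<open>p\<close> from \<open>1 - z^p\<close> cancels against the
  \<open>p\<close> possible marks.\<close>

lemma mark_coeff_0:
  assumes "norm q < 1" "q \<noteq> 0" "p > 0"
  shows "mark_coeff p q 0 * euler_prod (q ^ p) ^ 3 = layer_sum p q 0 * euler_prod q ^ 3"
proof -
  have qp: "norm (q ^ p) < 1" "q ^ p \<noteq> 0"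
    using assms norm_power_less_one by auto
  define f where "f = (\<lambda>z. mark_sum p q z * (euler_prod q * qpoch (z * q) q * qpoch (q / z) q))"
  define g where "g = (\<lambda>z. mark_coeff p q 0 * (euler_prod (q ^ p) * (\<Sum>i<p. z ^ i) *
      qpoch (z ^ p * q ^ p) (q ^ p) * qpoch (q ^ p / z ^ p) (q ^ p)))"
  have lim_f: "(f \<longlongrightarrow> mark_sum p q 1 * (euler_prod q * qpoch (1 * q) q * qpoch (q / 1) q)) (at 1)"
    unfolding f_def using assms by (intro tendsto_intros tendsto_mark_sum_1) auto
  have lim_g: "(g \<longlongrightarrow> mark_coeff p q 0 * (euler_prod (q ^ p) * (\<Sum>i<p. 1 ^ i) *
      qpoch (1 ^ p * q ^ p) (q ^ p) * qpoch (q ^ p / 1 ^ p) (q ^ p))) (at 1)"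
    unfolding g_def using qp by (intro tendsto_intros) auto
  have "\<forall>\<^sub>F z in at 1. f z = g z"
  proof -
    have "\<forall>\<^sub>F z in at (1::complex). z \<noteq> 0"
      by (rule tendsto_imp_eventually_ne[of "\<lambda>z. z" 1]) auto
    moreover have "\<forall>\<^sub>F z in at (1::complex). z \<noteq> 1"
      by (simp add: eventually_at_filter)
    ultimately show ?thesis
    proof eventually_elim
      case (elim z)
      have "(1 - z) * f z = mark_sum p q z * theta q (- z)"
        using elim jacobi_triple_product[OF assms(1,2), of "- z"] qpoch_Suc[OF assms(1), of z]
        by (simp add: f_def mult_ac)
      also have "\<dots> = mark_coeff p q 0 * theta (q ^ p) (- (z ^ p))"
        using assms elim by (intro mark_sum_times_theta_eq) auto
      also have "\<dots> = (1 - z) * g z"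
        using elim jacobi_triple_product[OF qp, of "- (z ^ p)"] qpoch_Suc[OF qp(1), of "z ^ p"]
          one_diff_power_eq[of z p]
        by (simp add: g_def mult_ac)
      finally show ?case
        using elim by simp
    qed
  qed
  from Lim_transform_eventually[OF lim_f this] lim_g
  have "mark_sum p q 1 * (euler_prod q * qpoch (1 * q) q * qpoch (q / 1) q) =
      mark_coeff p q 0 * (euler_prod (q ^ p) * (\<Sum>i<p. 1 ^ i) *
      qpoch (1 ^ p * q ^ p) (q ^ p) * qpoch (q ^ p / 1 ^ p) (q ^ p))"
    by (rule tendsto_unique[OF trivial_limit_at])
  thus ?thesis
    using assms mark_sum_1[OF assms] by (simp add: power3_eq_cube mult_ac)
qed

text \<open>The constant in \<open>mark_sum_times_theta_eq\<close> is known from \<open>mark_coeff_0\<close>. Multiplying by a further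
  core series makes the powers of \<open>E(q)\<close> cancel and leaves exactly the power of \<open>E(q^p)\<close> that occurs in the
  eta quotient.\<close>

theorem mark_sum_product:
  assumes "norm q < 1" "q \<noteq> 0" "p > 0" "z \<noteq> 0"
    and nz: "qpoch z q \<noteq> 0" "qpoch (q / z) q \<noteq> 0"
  shows "layer_sum p q 0 * mark_sum p q z =
    euler_prod (q ^ p) ^ (2 * (p - 1)) * (qpoch (z ^ p) (q ^ p) * qpoch (q ^ p / z ^ p) (q ^ p)) /
      (qpoch z q * qpoch (q / z) q)"
proof -
  have qp: "norm (q ^ p) < 1" "q ^ p \<noteq> 0"
    using assms norm_power_less_one by auto
  define E E' L M where "E = euler_prod q" and "E' = euler_prod (q ^ p)"
    and "L = layer_sum p q 0" and "M = mark_sum p q z"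
  define D D' where "D = qpoch z q * qpoch (q / z) q"
    and "D' = qpoch (z ^ p) (q ^ p) * qpoch (q ^ p / z ^ p) (q ^ p)"
  define c where "c = mark_coeff p q 0"
  have E: "E \<noteq> 0" "E' \<noteq> 0"
    using qpoch_nonzero_disk[OF assms(1,1)] qpoch_nonzero_disk[OF qp(1,1)] by (simp_all add: E_def E'_def)
  have L: "L * E = E' ^ p"
    using core_generating_function[OF assms(1-3)] E by (simp add: L_def E_def E'_def)
  have c: "c * E' ^ 3 = L * E ^ 3"
    using mark_coeff_0[OF assms(1-3)] by (simp add: c_def L_def E_def E'_def)
  have "M * theta q (- z) = c * theta (q ^ p) (- (z ^ p))"
    using mark_sum_times_theta_eq[OF assms(1-4)] by (simp add: M_def c_def)
  hence MD: "M * (E * D) = c * (E' * D')"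
    using jacobi_triple_product[OF assms(1,2), of "- z"] jacobi_triple_product[OF qp, of "- (z ^ p)"] assms
    by (simp add: E_def E'_def D_def D'_def mult_ac)
  have "(L * M * D) * (E * E' ^ 2) = L * (M * (E * D)) * E' ^ 2"
    by (simp add: mult_ac)
  also have "\<dots> = L * (c * E' ^ 3) * D'"
    unfolding MD by (simp add: mult_ac power2_eq_square power3_eq_cube)
  also have "\<dots> = (L * E) * (L * E) * D' * E"
    unfolding c by (simp add: mult_ac power3_eq_cube)
  also have "(L * E) * (L * E) = E' ^ (2 * (p - 1)) * E' ^ 2"
    unfolding L using assms(3) by (cases p) (simp_all add: power_add power2_eq_square mult_2)
  also have "E' ^ (2 * (p - 1)) * E' ^ 2 * D' * E = (E' ^ (2 * (p - 1)) * D') * (E * E' ^ 2)"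
    by (simp add: mult_ac)
  finally have "L * M * D = E' ^ (2 * (p - 1)) * D'"
    using E by simp
  moreover have "D \<noteq> 0"
    using nz by (simp add: D_def)
  ultimately show ?thesis
    by (simp add: L_def M_def D_def D'_def E'_def field_simps)
qed

section \<open>Functions with natural power series coefficients\<close>

text \<open>The point \<open>q = 0\<close> is excluded because the lattice sums are defined with integer powers of \<open>q\<close>.\<close>

definition nat_power_series :: "(complex \<Rightarrow> complex) \<Rightarrow> bool" where
  "nat_power_series f \<longleftrightarrow>
     (\<exists>a :: nat \<Rightarrow> nat. \<forall>q. 0 < norm q \<and> norm q < 1 \<longrightarrow> (\<lambda>n. of_nat (a n) * q ^ n) sums f q)"

lemma nat_power_series_cong:
  assumes "nat_power_series f" "\<And>q. 0 < norm q \<Longrightarrow> norm q < 1 \<Longrightarrow> f q = g q"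
  shows "nat_power_series g"
  using assms unfolding nat_power_series_def by metis

lemma nat_power_series_1 [intro]: "nat_power_series (\<lambda>_. 1)"
  unfolding nat_power_series_def
proof (intro exI allI impI)
  fix q :: complex
  have "(\<lambda>n. if n = 0 then 1 else 0 :: complex) sums 1"
    using sums_single[of 0 "\<lambda>_. 1 :: complex"] by simp
  also have "(\<lambda>n. if n = 0 then 1 else 0 :: complex) = (\<lambda>n. of_nat (if n = 0 then 1 else 0) * q ^ n)"
    by auto
  finally show "(\<lambda>n. of_nat (if n = 0 then 1 else 0) * q ^ n) sums 1" .
qed

lemma nat_power_series_mult [intro]:
  assumes "nat_power_series f" "nat_power_series g"
  shows "nat_power_series (\<lambda>q. f q * g q)"
proof -
  from assms obtain a b :: "nat \<Rightarrow> nat" where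
    a: "(\<lambda>n. of_nat (a n) * q ^ n) sums f q" and b: "(\<lambda>n. of_nat (b n) * q ^ n) sums g q"
    if "0 < norm q" "norm q < 1" for q
    unfolding nat_power_series_def by metis
  have "(\<lambda>n. of_nat (\<Sum>i\<le>n. a i * b (n - i)) * q ^ n) sums (f q * g q)"
    if q: "0 < norm q" "norm q < 1" for q
  proof -
    obtain r where r: "norm q < r" "r < 1"
      using dense[OF q(2)] by blast
    have "r > 0"
      using r(1) q(1) by linarith
    define x where "x = complex_of_real r"
    have x: "0 < norm x" "norm x < 1" "norm q < norm x"
      using r \<open>r > 0\<close> by (auto simp: x_def)
    have "summable (\<lambda>n. norm (of_nat (a n) * q ^ n))" "summable (\<lambda>n. norm (of_nat (b n) * q ^ n))"
      using powser_insidea[OF sums_summable[OF a[OF x(1,2)]] x(3)]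
        powser_insidea[OF sums_summable[OF b[OF x(1,2)]] x(3)] .
    from Cauchy_product_sums[OF this]
    have "(\<lambda>n. \<Sum>i\<le>n. of_nat (a i) * q ^ i * (of_nat (b (n - i)) * q ^ (n - i))) sums (f q * g q)"
      using sums_unique[OF a[OF q]] sums_unique[OF b[OF q]] by simp
    also have "(\<lambda>n. \<Sum>i\<le>n. of_nat (a i) * q ^ i * (of_nat (b (n - i)) * q ^ (n - i))) =
        (\<lambda>n. of_nat (\<Sum>i\<le>n. a i * b (n - i)) * q ^ n)"
    proof
      fix n
      have summand: "of_nat (a i) * q ^ i * (of_nat (b (n - i)) * q ^ (n - i)) = of_nat (a i * b (n - i)) * q ^ n"
        if "i \<le> n" for i
      proof -
        have "q ^ n = q ^ i * q ^ (n - i)"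
          using that by (simp flip: power_add)
        thus ?thesis
          by simp
      qed
      show "(\<Sum>i\<le>n. of_nat (a i) * q ^ i * (of_nat (b (n - i)) * q ^ (n - i))) =
          of_nat (\<Sum>i\<le>n. a i * b (n - i)) * q ^ n"
        unfolding of_nat_sum sum_distrib_right by (intro sum.cong refl summand) auto
    qed
    finally show ?thesis .
  qed
  thus ?thesis
    unfolding nat_power_series_def by metis
qed

lemma nat_power_series_power:
  assumes "nat_power_series f"
  shows "nat_power_series (\<lambda>q. f q ^ n)"
  by (induction n) (use assms in auto)

lemma nat_power_series_prod:
  assumes "\<And>i. i \<in> I \<Longrightarrow> nat_power_series (f i)"
  shows "nat_power_series (\<lambda>q. \<Prod>i\<in>I. f i q)"
  using assms by (induction I rule: infinite_finite_induct) auto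

lemma nat_power_series_compose_power:
  assumes "nat_power_series f" "k > 0"
  shows "nat_power_series (\<lambda>q. f (q ^ k))"
proof -
  from assms obtain a :: "nat \<Rightarrow> nat" where
    a: "(\<lambda>n. of_nat (a n) * q ^ n) sums f q" if "0 < norm q" "norm q < 1" for q
    unfolding nat_power_series_def by metis
  define b where "b = (\<lambda>n. if k dvd n then a (n div k) else 0)"
  have "(\<lambda>n. of_nat (b n) * q ^ n) sums f (q ^ k)" if q: "0 < norm q" "norm q < 1" for q
  proof -
    have "(\<lambda>n. of_nat (a n) * (q ^ k) ^ n) sums f (q ^ k)"
      using q assms(2) by (intro a) (auto simp: norm_power power_less_one_iff)
    also have "(\<lambda>n. of_nat (a n) * (q ^ k) ^ n) = (\<lambda>n. of_nat (b (k * n)) * q ^ (k * n))"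
      using assms(2) by (simp add: b_def power_mult)
    finally show ?thesis
      using assms(2) by (subst (asm) sums_mono_reindex) (auto simp: b_def strict_mono_def)
  qed
  thus ?thesis
    unfolding nat_power_series_def by metis
qed

text \<open>The \<open>n\<close>-th coefficient counts the indices with exponent \<open>n\<close>. Convergence at \<open>q = 1/2\<close> shows that
  there are only finitely many of them.\<close>

lemma nat_power_series_has_sum:
  assumes "\<And>q. 0 < norm q \<Longrightarrow> norm q < 1 \<Longrightarrow> ((\<lambda>i. q ^ e i) has_sum f q) I"
  shows "nat_power_series f"
proof -
  have fin: "finite {i \<in> I. e i = n}" for n
  proof (rule ccontr)
    assume inf: "infinite {i \<in> I. e i = n}"
    have "(\<lambda>i. (1 / 2 :: complex) ^ e i) summable_on I"
      using assms[of "1/2"] by (auto simp: summable_on_def)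
    hence "(\<lambda>i. norm ((1 / 2 :: complex) ^ e i)) summable_on I"
      by (simp only: summable_on_iff_abs_summable_on_complex)
    hence "(\<lambda>i. norm ((1 / 2 :: complex) ^ e i)) summable_on {i \<in> I. e i = n}"
      by (rule summable_on_subset_banach) auto
    also have "?this \<longleftrightarrow> (\<lambda>i. (1 / 2 :: real) ^ n) summable_on {i \<in> I. e i = n}"
      by (rule summable_on_cong) (auto simp: norm_power norm_divide)
    finally show False
      using infsum_diverge_constant[OF inf, of "(1 / 2 :: real) ^ n"] by simp
  qed
  have "(\<lambda>n. of_nat (card {i \<in> I. e i = n}) * q ^ n) sums f q" if q: "0 < norm q" "norm q < 1" for q
  proof -
    have bij: "bij_betw snd (Sigma UNIV (\<lambda>n. {i \<in> I. e i = n})) I"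
      by (rule bij_betwI[where g = "\<lambda>i. (e i, i)"]) auto
    have "((\<lambda>x. q ^ e (snd x)) has_sum f q) (Sigma UNIV (\<lambda>n. {i \<in> I. e i = n}))"
      using assms[OF q] by (subst has_sum_reindex_bij_betw[OF bij, of "\<lambda>i. q ^ e i"])
    hence "((\<lambda>n. of_nat (card {i \<in> I. e i = n}) * q ^ n) has_sum f q) UNIV"
    proof (rule has_sum_SigmaD)
      fix n
      show "((\<lambda>y. q ^ e (snd (n, y))) has_sum of_nat (card {i \<in> I. e i = n}) * q ^ n) {i \<in> I. e i = n}"
        using fin by (intro has_sum_finiteI) auto
    qed
    thus ?thesis
      by (rule has_sum_imp_sums)
  qed
  thus ?thesis
    unfolding nat_power_series_def by metis
qed

lemma nat_power_series_core:
  assumes "p > 0"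
  shows "nat_power_series (\<lambda>q. euler_prod (q ^ p) ^ p / euler_prod q)"
proof (rule nat_power_series_has_sum)
  fix q :: complex assume q: "0 < norm q" "norm q < 1"
  have "((\<lambda>n. q powi weight p n) has_sum layer_sum p q 0) (layer p 0)"
    using q assms by (intro has_sum_layer) auto
  also have "(\<lambda>n. q powi weight p n) = (\<lambda>n. q ^ nat (weight p n))"
    using weight_nonneg by (simp add: power_int_def)
  also have "layer_sum p q 0 = euler_prod (q ^ p) ^ p / euler_prod q"
    using q assms by (intro core_generating_function) auto
  finally show "((\<lambda>n. q ^ nat (weight p n)) has_sum (euler_prod (q ^ p) ^ p / euler_prod q)) (layer p 0)" .
qed

text \<open>After the substitution \<open>Q = q^M\<close>, \<open>z = q^b\<close> the term of a marked vector with weight \<open>w\<close> and position \<open>l\<close> has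
  exponent \<open>M w + b l = (M - b) w + b (w + l)\<close>, and both \<open>w\<close> and \<open>w + l\<close> are nonnegative.\<close>

lemma nat_power_series_pair:
  assumes "p > 0" "0 < b" "b < M"
  shows "nat_power_series (\<lambda>q. euler_prod (q ^ (p * M)) ^ (2 * (p - 1)) *
     (qpoch (q ^ (p * b)) (q ^ (p * M)) * qpoch (q ^ (p * (M - b))) (q ^ (p * M))) /
     (qpoch (q ^ b) (q ^ M) * qpoch (q ^ (M - b)) (q ^ M)))"
proof -
  have "nat_power_series (\<lambda>q. mark_sum p (q ^ M) (q ^ b))"
  proof (rule nat_power_series_has_sum)
    fix q :: complex assume q: "0 < norm q" "norm q < 1"
    define e where "e = (\<lambda>x. int M * weight p (fst x) + int b * position p x)"
    have "((\<lambda>x. mark_term p (q ^ M) (q ^ b) x) has_sum mark_sum p (q ^ M) (q ^ b)) (marked p)"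
      using q assms norm_power_less_one[of q M] by (intro has_sum_mark_sum) auto
    also have "?this \<longleftrightarrow> ((\<lambda>x. q ^ nat (e x)) has_sum mark_sum p (q ^ M) (q ^ b)) (marked p)"
    proof (rule has_sum_cong)
      fix x assume x: "x \<in> marked p"
      have "e x = int (M - b) * weight p (fst x) + int b * (weight p (fst x) + position p x)"
        using assms by (simp add: e_def algebra_simps of_nat_diff)
      also have "\<dots> \<ge> 0"
        by (intro add_nonneg_nonneg[OF mult_nonneg_nonneg mult_nonneg_nonneg] weight_nonneg
            weight_position_nonneg[OF x]) auto
      finally have "q ^ nat (e x) = q powi e x"
        by (simp add: power_int_def)
      also have "\<dots> = mark_term p (q ^ M) (q ^ b) x"
        using q by (simp add: e_def mark_term_def power_int_add power_int_mult)
      finally show "mark_term p (q ^ M) (q ^ b) x = q ^ nat (e x)" ..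
    qed
    finally show "((\<lambda>x. q ^ nat (e x)) has_sum mark_sum p (q ^ M) (q ^ b)) (marked p)" .
  qed
  moreover have "nat_power_series (\<lambda>q. euler_prod ((q ^ M) ^ p) ^ p / euler_prod (q ^ M))"
    using nat_power_series_compose_power[OF nat_power_series_core[OF assms(1)], of M] assms by simp
  ultimately have "nat_power_series (\<lambda>q. (euler_prod ((q ^ M) ^ p) ^ p / euler_prod (q ^ M)) * mark_sum p (q ^ M) (q ^ b))"
    by (rule nat_power_series_mult[rotated])
  thus ?thesis
  proof (rule nat_power_series_cong)
    fix q :: complex assume q: "0 < norm q" "norm q < 1"
    have qM: "norm (q ^ M) < 1" "q ^ M \<noteq> 0" "q ^ b \<noteq> 0"
      using q assms norm_power_less_one[of q M] by auto
    have "q ^ M = q ^ (M - b) * q ^ b"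
      using assms by (simp flip: power_add)
    hence div: "q ^ M / q ^ b = q ^ (M - b)"
      using qM by simp
    have "norm (q ^ b) < 1" "norm (q ^ (M - b)) < 1"
      using q assms by (intro norm_power_less_one; simp)+
    hence nz: "qpoch (q ^ b) (q ^ M) \<noteq> 0" "qpoch (q ^ M / q ^ b) (q ^ M) \<noteq> 0"
      unfolding div using qM by (simp_all add: qpoch_nonzero_disk)
    have "(q ^ M) ^ p / (q ^ b) ^ p = (q ^ (M - b)) ^ p"
      by (simp only: div flip: power_divide)
    thus "(euler_prod ((q ^ M) ^ p) ^ p / euler_prod (q ^ M)) * mark_sum p (q ^ M) (q ^ b) =
      euler_prod (q ^ (p * M)) ^ (2 * (p - 1)) *
      (qpoch (q ^ (p * b)) (q ^ (p * M)) * qpoch (q ^ (p * (M - b))) (q ^ (p * M))) /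
      (qpoch (q ^ b) (q ^ M) * qpoch (q ^ (M - b)) (q ^ M))"
      using mark_sum_product[OF qM(1,2) assms(1) qM(3) nz] core_generating_function[OF qM(1,2) assms(1)]
      unfolding div by (simp add: mult.commute[of p] flip: power_mult)
  qed
qed

section \<open>Eta quotients as products over reduced residues\<close>

lemma moebius_mu_prime_mult:
  assumes "prime p" "\<not> p dvd e"
  shows "moebius_mu (p * e) = - moebius_mu e"
proof -
  have e: "e \<noteq> 0"
  proof
    assume "e = 0"
    with assms(2) show False
      by simp
  qed
  have "coprime p e"
    using assms by (rule prime_imp_coprime)
  hence sq: "squarefree (p * e) \<longleftrightarrow> squarefree e"
    using assms squarefree_mult_coprime[of p e] squarefree_multD[of p e] by (auto simp: squarefree_prime)
  have "prime_factors (p * e) = insert p (prime_factors e)"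
    using assms e by (auto simp: prime_factors_product prime_prime_factors)
  moreover have "p \<notin> prime_factors e"
    using assms by (auto simp: in_prime_factors_iff)
  ultimately have "card (prime_factors (p * e)) = Suc (card (prime_factors e))"
    by simp
  thus ?thesis
    by (simp add: moebius_mu_def sq)
qed

text \<open>For a prime \<open>p\<close> dividing \<open>n\<close>, the divisors \<open>e\<close> prime to \<open>p\<close> cancel against the divisors \<open>p e\<close>; divisors
  that are multiples of \<open>p\<^sup>2\<close> contribute nothing.\<close>

lemma sum_moebius_mu:
  assumes "n > 0"
  shows "(\<Sum>d | d dvd n. moebius_mu d) = (if n = 1 then 1 else 0)"
proof (cases "n = 1")
  case True
  have "{d::nat. d dvd 1} = {1}"
    by auto
  thus ?thesis
    using True by (simp add: moebius_mu_def)
next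
  case False
  then obtain p where p: "prime p" "p dvd n"
    using prime_factor_nat by blast
  define A where "A = {d. d dvd n \<and> \<not> p dvd d}"
  have fin: "finite {d. d dvd n}"
    using assms by simp
  hence fin': "finite A"
    by (rule rev_finite_subset) (auto simp: A_def)
  have sub: "(*) p ` A \<subseteq> {d. d dvd n \<and> p dvd d}"
  proof safe
    fix d assume "d \<in> A"
    hence "coprime p d" "d dvd n"
      using p by (auto simp: A_def intro: prime_imp_coprime)
    thus "p * d dvd n"
      using p by (intro divides_mult) auto
  qed auto
  have "(\<Sum>d | d dvd n. moebius_mu d) = (\<Sum>d\<in>A. moebius_mu d) + (\<Sum>d | d dvd n \<and> p dvd d. moebius_mu d)"
    using fin by (subst sum.union_disjoint [symmetric]) (auto simp: A_def intro!: sum.cong)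
  also have "(\<Sum>d | d dvd n \<and> p dvd d. moebius_mu d) = (\<Sum>d\<in>(*) p ` A. moebius_mu d)"
  proof (rule sum.mono_neutral_right)
    show "\<forall>d\<in>{d. d dvd n \<and> p dvd d} - (*) p ` A. moebius_mu d = 0"
    proof safe
      fix d assume d: "d dvd n" "p dvd d" "d \<notin> (*) p ` A"
      then obtain e where e: "d = p * e"
        by auto
      hence "e dvd n"
        using d(1) by (auto dest: dvd_mult_right)
      hence "p dvd e"
        using d(3) e by (auto simp: A_def)
      hence "p ^ 2 dvd d"
        using e by (simp add: power2_eq_square)
      moreover have "\<not> p dvd 1"
        using p by auto
      ultimately have "\<not> squarefree d"
        by (auto simp: squarefree_def)
      thus "moebius_mu d = 0"
        by (simp add: moebius_mu_def)
    qed
  qed (use fin sub in auto)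
  also have "\<dots> = (\<Sum>e\<in>A. moebius_mu (p * e))"
    using p by (subst sum.reindex) (auto simp: inj_on_def)
  also have "\<dots> = (\<Sum>e\<in>A. - moebius_mu e)"
    by (intro sum.cong refl moebius_mu_prime_mult p) (auto simp: A_def)
  finally show ?thesis
    using False by (simp add: sum_negf)
qed

lemma euler_prod_divisor:
  assumes "norm q < 1" "N > 0" "d dvd N"
  shows "euler_prod (q ^ d) = (\<Prod>a | a \<in> {1..N} \<and> d dvd a. qpoch (q ^ a) (q ^ N))"
proof -
  obtain k where k: "N = d * k"
    using assms by auto
  have dk: "d > 0" "k > 0"
    using assms k by auto
  have "euler_prod (q ^ d) = (\<Prod>i<k. qpoch (q ^ d * (q ^ d) ^ i) ((q ^ d) ^ k))"
    by (rule qpoch_multisection [symmetric]) (use assms dk in \<open>auto intro: norm_power_less_one\<close>)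
  also have "\<dots> = (\<Prod>a | a \<in> {1..N} \<and> d dvd a. qpoch (q ^ a) (q ^ N))"
  proof (rule prod.reindex_bij_witness[of _ "\<lambda>a. a div d - 1" "\<lambda>i. d * Suc i"])
    fix a assume a: "a \<in> {a \<in> {1..N}. d dvd a}"
    then obtain j where j: "a = d * j"
      by auto
    with a dk have "j > 0" "j \<le> k"
      by (auto simp: k)
    thus "d * Suc (a div d - 1) = a" "a div d - 1 \<in> {..<k}"
      using dk by (auto simp: j)
  qed (use dk in \<open>auto simp: k power_add power_mult simp del: mult_Suc_right intro!: mult_le_mono\<close>)
  finally show ?thesis .
qed

lemma prod_power_int:
  fixes x :: "'a :: field"
  assumes "x \<noteq> 0" "finite A"
  shows "(\<Prod>i\<in>A. x powi f i) = x powi (\<Sum>i\<in>A. f i)"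
  using assms(2) by induction (use assms(1) in \<open>auto simp: power_int_add\<close>)

lemma power_int_prod_distrib:
  fixes f :: "'a \<Rightarrow> 'b :: field"
  shows "(\<Prod>i\<in>A. f i) powi n = (\<Prod>i\<in>A. f i powi n)"
  by (induction A rule: infinite_finite_induct) (auto simp: power_int_mult_distrib)

text \<open>Each \<open>E(q^d)\<close> is the product of \<open>(q^a; q^N)\<close> over the multiples \<open>a \<le> N\<close> of \<open>d\<close>, so the exponent of
  \<open>(q^a; q^N)\<close> is the sum of \<open>\<mu>(d)\<close> over the common divisors \<open>d\<close> of \<open>a\<close> and \<open>N\<close>.\<close>

lemma moebius_product:
  assumes "norm q < 1" "q \<noteq> 0" "N > 0"
  shows "(\<Prod>d | d dvd N. euler_prod (q ^ d) powi moebius_mu d) = (\<Prod>a\<in>totatives N. qpoch (q ^ a) (q ^ N))"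
proof -
  define f where "f = (\<lambda>a. qpoch (q ^ a) (q ^ N))"
  have fin: "finite {d. d dvd N}"
    using assms by simp
  have nz: "f a \<noteq> 0" if "a \<ge> 1" for a
    unfolding f_def using that assms by (intro qpoch_nonzero_disk norm_power_less_one) auto
  have "(\<Prod>d | d dvd N. euler_prod (q ^ d) powi moebius_mu d) =
      (\<Prod>d | d dvd N. \<Prod>a\<in>{1..N}. if d dvd a then f a powi moebius_mu d else 1)"
  proof (rule prod.cong)
    fix d assume "d \<in> {d. d dvd N}"
    hence "euler_prod (q ^ d) = (\<Prod>a | a \<in> {1..N} \<and> d dvd a. f a)"
      unfolding f_def using assms by (intro euler_prod_divisor) auto
    thus "euler_prod (q ^ d) powi moebius_mu d = (\<Prod>a\<in>{1..N}. if d dvd a then f a powi moebius_mu d else 1)"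
      by (simp only: power_int_prod_distrib prod.inter_filter finite_atLeastAtMost)
         (auto intro!: prod.cong)
  qed simp
  also have "\<dots> = (\<Prod>a\<in>{1..N}. \<Prod>d | d dvd N. if d dvd a then f a powi moebius_mu d else 1)"
    by (rule prod.swap)
  also have "\<dots> = (\<Prod>a\<in>{1..N}. if coprime a N then f a else 1)"
  proof (rule prod.cong)
    fix a assume a: "a \<in> {1..N}"
    have "(\<Prod>d | d dvd N. if d dvd a then f a powi moebius_mu d else 1) =
        (\<Prod>d\<in>{d \<in> {d. d dvd N}. d dvd a}. f a powi moebius_mu d)"
      using fin by (rule prod.inter_filter [symmetric])
    also have "{d \<in> {d. d dvd N}. d dvd a} = {d. d dvd gcd a N}"
      by auto
    also have "(\<Prod>d\<in>{d. d dvd gcd a N}. f a powi moebius_mu d) = f a powi (\<Sum>d | d dvd gcd a N. moebius_mu d)"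
      using a assms nz[of a] by (intro prod_power_int) auto
    also have "(\<Sum>d | d dvd gcd a N. moebius_mu d) = (if coprime a N then 1 else 0)"
      unfolding coprime_iff_gcd_eq_1 using assms by (intro sum_moebius_mu) simp
    also have "f a powi (if coprime a N then 1 else 0) = (if coprime a N then f a else 1)"
      by simp
    finally show "(\<Prod>d | d dvd N. if d dvd a then f a powi moebius_mu d else 1) = (if coprime a N then f a else 1)" .
  qed simp
  also have "\<dots> = (\<Prod>a\<in>{a \<in> {1..N}. coprime a N}. f a)"
    by (rule prod.inter_filter [symmetric]) simp
  also have "{a \<in> {1..N}. coprime a N} = totatives N"
    by (auto simp: in_totatives_iff)
  finally show ?thesis
    by (simp add: f_def)
qed

section \<open>Nonnegativity by induction on the level\<close>

text \<open>By \<open>moebius_product\<close>, this is the eta quotient without its fractional power of \<open>q\<close>.\<close>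

definition level_quotient :: "nat \<Rightarrow> complex \<Rightarrow> complex" where
  "level_quotient N q = euler_prod (q ^ N) ^ totient N / (\<Prod>a\<in>totatives N. qpoch (q ^ a) (q ^ N))"

text \<open>Each residue class modulo \<open>M\<close> splits into \<open>p\<close> classes modulo \<open>p M\<close>, and coprimality to \<open>M\<close>
  depends only on the class modulo \<open>M\<close>.\<close>

lemma prod_coprime_refine:
  assumes "norm q < 1" "M > 0" "p > 0"
  shows "(\<Prod>a | a \<in> {1..p * M} \<and> coprime a M. qpoch (q ^ a) (q ^ (p * M))) =
         (\<Prod>b\<in>totatives M. qpoch (q ^ b) (q ^ M))"
proof -
  have coprime_shift: "coprime (x + i * M) M \<longleftrightarrow> coprime x M" for x i
    by (metis coprime_iff_gcd_eq_1 gcd.commute gcd_add_mult add.commute)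
  have "(\<Prod>b\<in>totatives M. qpoch (q ^ b) (q ^ M)) =
      (\<Prod>b\<in>totatives M. \<Prod>i<p. qpoch (q ^ b * (q ^ M) ^ i) ((q ^ M) ^ p))"
    using assms by (intro prod.cong qpoch_multisection [symmetric] norm_power_less_one) auto
  also have "\<dots> = (\<Prod>(b, i)\<in>totatives M \<times> {..<p}. qpoch (q ^ b * (q ^ M) ^ i) ((q ^ M) ^ p))"
    by (rule prod.cartesian_product)
  also have "\<dots> = (\<Prod>a | a \<in> {1..p * M} \<and> coprime a M. qpoch (q ^ a) (q ^ (p * M)))"
  proof (rule prod.reindex_bij_witness[of _ "\<lambda>a. (Suc ((a - 1) mod M), (a - 1) div M)" "\<lambda>(b, i). b + i * M"])
    fix x assume "x \<in> totatives M \<times> {..<p}"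
    then obtain b i where x: "x = (b, i)" "b > 0" "b \<le> M" "coprime b M" "i < p"
      by (auto simp: in_totatives_iff)
    have "b - 1 < M" "b + i * M - 1 = b - 1 + i * M"
      using x by auto
    hence "(b + i * M - 1) mod M = b - 1" "(b + i * M - 1) div M = i"
      by (simp_all del: One_nat_def)
    thus "(Suc (((case x of (b, i) \<Rightarrow> b + i * M) - 1) mod M), ((case x of (b, i) \<Rightarrow> b + i * M) - 1) div M) = x"
      using x by (simp del: One_nat_def)
    have "Suc i * M \<le> p * M"
      using x by (intro mult_right_mono) auto
    moreover have "coprime (b + i * M) M"
      using x(4) by (simp only: coprime_shift)
    ultimately show "(case x of (b, i) \<Rightarrow> b + i * M) \<in> {a. a \<in> {1..p * M} \<and> coprime a M}"
      using x by auto
    show "qpoch (q ^ (case x of (b, i) \<Rightarrow> b + i * M)) (q ^ (p * M)) =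
        (case x of (b, i) \<Rightarrow> qpoch (q ^ b * (q ^ M) ^ i) ((q ^ M) ^ p))"
      using x by (simp add: power_add mult.commute flip: power_mult)
  next
    fix a assume a: "a \<in> {a. a \<in> {1..p * M} \<and> coprime a M}"
    have eq: "Suc ((a - 1) mod M) + (a - 1) div M * M = a"
      using a mod_div_mult_eq[of "a - 1" M] by simp
    thus "(case (Suc ((a - 1) mod M), (a - 1) div M) of (b, i) \<Rightarrow> b + i * M) = a"
      by simp
    have "coprime (Suc ((a - 1) mod M) + (a - 1) div M * M) M"
      unfolding eq using a by simp
    hence "coprime (Suc ((a - 1) mod M)) M"
      by (simp only: coprime_shift)
    moreover have "(a - 1) div M < p"
      using a assms by (auto simp: less_mult_imp_div_less)
    ultimately show "(Suc ((a - 1) mod M), (a - 1) div M) \<in> totatives M \<times> {..<p}"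
      using assms by (auto simp: in_totatives_iff Suc_le_eq)
  qed
  finally show ?thesis ..
qed

lemma totatives_nonzero:
  assumes "norm q < 1" "N > 0"
  shows "(\<Prod>a\<in>totatives N. qpoch (q ^ a) (q ^ N)) \<noteq> 0"
proof -
  have "qpoch (q ^ a) (q ^ N) \<noteq> 0" if "a \<in> totatives N" for a
    using that assms by (intro qpoch_nonzero_disk norm_power_less_one) (auto simp: in_totatives_iff)
  thus ?thesis
    by simp
qed

lemma level_quotient_dvd:
  assumes "norm q < 1" "prime p" "M > 0" "p dvd M"
  shows "level_quotient (p * M) q = level_quotient M q * (euler_prod ((q ^ M) ^ p) ^ p / euler_prod (q ^ M)) ^ totient M"
proof -
  have p: "p > 0"
    using assms by (simp add: prime_gt_0_nat)
  have E: "euler_prod (q ^ M) \<noteq> 0"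
    using assms by (intro qpoch_nonzero_disk norm_power_less_one) auto
  have "coprime a p" if "coprime a M" for a
    using coprime_divisors[OF dvd_refl assms(4) that] .
  hence "{a. a \<in> {1..p * M} \<and> coprime a M} = totatives (p * M)"
    by (auto simp: in_totatives_iff)
  with prod_coprime_refine[OF assms(1,3) p]
  have "(\<Prod>a\<in>totatives (p * M). qpoch (q ^ a) (q ^ (p * M))) = (\<Prod>b\<in>totatives M. qpoch (q ^ b) (q ^ M))"
    by simp
  moreover have "totient (p * M) = p * totient M"
  proof -
    have "totient (p * M) * totient p = totient p * totient M * p"
      using totient_gcd[of p M] assms by (simp add: gcd_nat.absorb1)
    thus ?thesis
      using p by simp
  qed
  ultimately show ?thesis
    using E by (simp add: level_quotient_def power_divide mult.commute[of p M] power_mult)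
qed

text \<open>Among the residues modulo \<open>p M\<close> that are coprime to \<open>M\<close>, those divisible by \<open>p\<close> are the numbers
  \<open>p b\<close> with \<open>b\<close> coprime to \<open>M\<close>; they must be removed from the refined product.\<close>

lemma level_quotient_coprime:
  assumes "norm q < 1" "prime p" "M > 0" "\<not> p dvd M"
  shows "level_quotient (p * M) q =
    (\<Prod>b\<in>totatives M. euler_prod (q ^ (p * M)) ^ (p - 1) * qpoch (q ^ (p * b)) (q ^ (p * M)) / qpoch (q ^ b) (q ^ M))"
proof -
  have p: "p > 0"
    using assms by (simp add: prime_gt_0_nat)
  have cop: "coprime p M"
    using assms by (intro prime_imp_coprime)
  define f where "f = (\<lambda>a. qpoch (q ^ a) (q ^ (p * M)))"
  have "{a. a \<in> {1..p * M} \<and> coprime a M} = totatives (p * M) \<union> (*) p ` totatives M"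
  proof safe
    fix a assume a: "a \<in> {1..p * M}" "coprime a M" "a \<notin> (*) p ` totatives M"
    have "\<not> p dvd a"
    proof
      assume "p dvd a"
      then obtain b where "a = p * b"
        by auto
      with a p show False
        by (auto simp: in_totatives_iff coprime_mult_left_iff)
    qed
    hence "coprime a p"
      using assms prime_imp_coprime coprime_commute by blast
    thus "a \<in> totatives (p * M)"
      using a by (auto simp: in_totatives_iff coprime_mult_right_iff)
  qed (use p cop in \<open>auto simp: in_totatives_iff coprime_mult_left_iff coprime_mult_right_iff\<close>)
  hence "(\<Prod>b\<in>totatives M. qpoch (q ^ b) (q ^ M)) = (\<Prod>a\<in>totatives (p * M) \<union> (*) p ` totatives M. f a)"
    using prod_coprime_refine[OF assms(1,3) p] by (simp add: f_def)
  also have "\<dots> = (\<Prod>a\<in>totatives (p * M). f a) * (\<Prod>a\<in>(*) p ` totatives M. f a)"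
    using assms by (intro prod.union_disjoint) (auto simp: in_totatives_iff)
  also have "(\<Prod>a\<in>(*) p ` totatives M. f a) = (\<Prod>b\<in>totatives M. f (p * b))"
    using p by (subst prod.reindex) (auto simp: inj_on_def)
  finally have eq: "(\<Prod>b\<in>totatives M. qpoch (q ^ b) (q ^ M)) =
      (\<Prod>a\<in>totatives (p * M). f a) * (\<Prod>b\<in>totatives M. f (p * b))" .
  have nz: "(\<Prod>b\<in>totatives M. qpoch (q ^ b) (q ^ M)) \<noteq> 0"
    using assms by (intro totatives_nonzero)
  have "totient (p * M) = (p - 1) * totient M"
    using cop assms by (simp add: totient_mult_coprime totient_prime)
  hence "(\<Prod>b\<in>totatives M. euler_prod (q ^ (p * M)) ^ (p - 1)) = euler_prod (q ^ (p * M)) ^ totient (p * M)"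
    by (simp add: totient_def power_mult)
  hence "(\<Prod>b\<in>totatives M. euler_prod (q ^ (p * M)) ^ (p - 1) * f (p * b) / qpoch (q ^ b) (q ^ M)) =
      euler_prod (q ^ (p * M)) ^ totient (p * M) * (\<Prod>b\<in>totatives M. f (p * b)) / (\<Prod>b\<in>totatives M. qpoch (q ^ b) (q ^ M))"
    by (simp add: prod_dividef prod.distrib)
  also have "\<dots> = level_quotient (p * M) q"
    using nz unfolding eq level_quotient_def f_def[symmetric] by simp
  finally show ?thesis
    by (simp add: f_def)
qed

theorem nat_power_series_level_quotient:
  assumes "N > 0"
  shows "nat_power_series (level_quotient N)"
  using assms
proof (induction N rule: less_induct)
  case (less N)
  show ?case
  proof (cases "\<exists>p M. prime p \<and> p dvd M \<and> N = p * M")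
    case True
    then obtain p M where pM: "prime p" "p dvd M" "N = p * M"
      by blast
    have M: "M > 0" "M < N"
      using pM less.prems prime_gt_1_nat[of p] by auto
    have "nat_power_series (\<lambda>q. level_quotient M q * (euler_prod ((q ^ M) ^ p) ^ p / euler_prod (q ^ M)) ^ totient M)"
      using nat_power_series_compose_power[OF nat_power_series_core[of p], of M] M pM
      by (intro nat_power_series_mult nat_power_series_power less.IH) (auto simp: prime_gt_0_nat)
    thus ?thesis
      by (rule nat_power_series_cong) (use level_quotient_dvd pM M in auto)
  next
    case squarefree: False
    show ?thesis
    proof (cases "N = 1")
      case True
      show ?thesis
      proof (rule nat_power_series_cong[OF nat_power_series_1])
        fix q :: complex assume q: "0 < norm q" "norm q < 1"
        thus "1 = level_quotient N q"
          using qpoch_nonzero_disk[of q q] by (simp add: level_quotient_def True)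
      qed
    next
      case False
      \<comment> \<open>the cofactor must be odd so that \<open>b \<mapsto> M - b\<close> has no fixed point below\<close>
      obtain p where p: "prime p" "p dvd N" "odd (N div p)"
      proof (cases "even N")
        case True
        have "odd (N div 2)"
          using squarefree True by (metis dvd_mult_div_cancel two_is_prime_nat)
        thus ?thesis
          using True that[of 2] by auto
      next
        case odd: False
        obtain p where "prime p" "p dvd N"
          using prime_factor_nat[OF False] by blast
        moreover from this have "odd (N div p)"
          using odd by (metis dvd_mult_div_cancel dvd_mult)
        ultimately show ?thesis
          using that by blast
      qed
      define M where "M = N div p"
      have N: "N = p * M"
        using p by (simp add: M_def)
      have M: "M > 0" "\<not> p dvd M" "odd M"
        using less.prems N squarefree p by (auto simp: M_def[symmetric])
      have p0: "p > 0"
        using p by (simp add: prime_gt_0_nat)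
      define F where "F = (\<lambda>b q. euler_prod (q ^ (p * M)) ^ (p - 1) * qpoch (q ^ (p * b)) (q ^ (p * M)) / qpoch (q ^ b) (q ^ M))"
      have "nat_power_series (\<lambda>q. \<Prod>b\<in>totatives M. F b q)"
      proof (cases "M = 1")
        case True
        have "F 1 = (\<lambda>q. euler_prod (q ^ p) ^ p / euler_prod q)"
          using p0 by (cases p) (auto simp: F_def True fun_eq_iff mult_ac)
        thus ?thesis
          using nat_power_series_core[OF p0] by (simp add: True)
      next
        case False
        define L where "L = {b \<in> totatives M. 2 * b < M}"
        have less: "0 < b" "b < M" if "b \<in> totatives M" for b
          using that False M by (auto simp: in_totatives_iff intro: totatives_less)
        have diff: "M - b \<in> totatives M" if "b \<in> totatives M" for b
        proof -
          have "gcd (M - b) M = gcd b M"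
            using less[OF that] by (intro gcd_diff2_nat) auto
          hence "coprime (M - b) M \<longleftrightarrow> coprime b M"
            by (simp only: coprime_iff_gcd_eq_1)
          thus ?thesis
            using that less[OF that] by (simp add: in_totatives_iff)
        qed
        have upper: "{b \<in> totatives M. \<not> 2 * b < M} = (\<lambda>b. M - b) ` L"
        proof (intro equalityI subsetI)
          fix b assume b: "b \<in> {b \<in> totatives M. \<not> 2 * b < M}"
          have "2 * b \<noteq> M"
            using M(3) by auto
          hence "M - b \<in> L" "b = M - (M - b)"
            using b diff[of b] less[of b] by (auto simp: L_def)
          thus "b \<in> (\<lambda>b. M - b) ` L"
            by blast
        next
          fix b assume "b \<in> (\<lambda>b. M - b) ` L"
          thus "b \<in> {b \<in> totatives M. \<not> 2 * b < M}"
            using diff by (auto simp: L_def)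
        qed
        have inj: "inj_on (\<lambda>b. M - b) L"
        proof (rule inj_onI)
          fix x y assume "x \<in> L" "y \<in> L" "M - x = M - y"
          thus "x = y"
            unfolding L_def by auto
        qed
        have "(\<Prod>b\<in>totatives M. F b q) = (\<Prod>b\<in>L. F b q * F (M - b) q)" for q
        proof -
          have "(\<Prod>b\<in>totatives M. F b q) = (\<Prod>b\<in>L. F b q) * (\<Prod>b\<in>{b \<in> totatives M. \<not> 2 * b < M}. F b q)"
            unfolding L_def by (subst prod.union_disjoint [symmetric]) (auto intro!: prod.cong)
          thus ?thesis
            unfolding upper using inj by (simp add: prod.reindex prod.distrib)
        qed
        moreover have "nat_power_series (\<lambda>q. \<Prod>b\<in>L. F b q * F (M - b) q)"
        proof (rule nat_power_series_prod)
          fix b assume "b \<in> L"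
          hence "0 < b" "b < M"
            using less by (auto simp: L_def)
          from nat_power_series_pair[OF p0 this]
          show "nat_power_series (\<lambda>q. F b q * F (M - b) q)"
            by (rule nat_power_series_cong) (simp add: F_def mult_2 power_add mult_ac)
        qed
        ultimately show ?thesis
          by simp
      qed
      thus ?thesis
      proof (rule nat_power_series_cong)
        fix q :: complex assume "0 < norm q" "norm q < 1"
        thus "(\<Prod>b\<in>totatives M. F b q) = level_quotient N q"
          using level_quotient_coprime[of q p M] p M by (simp add: N F_def)
      qed
    qed
  qed
qed

lemma dedekind_eta_mult:
  "dedekind_eta (of_nat d * \<tau>) =
     exp (of_real pi * \<i> * \<tau> / 12 * of_int (int d)) * euler_prod (exp (2 * of_real pi * \<i> * \<tau>) ^ d)"
proof -
  define q where "q = exp (2 * of_real pi * \<i> * \<tau>)"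
  have "exp (2 * of_real pi * \<i> * of_nat (Suc n) * (of_nat d * \<tau>)) = q ^ d * (q ^ d) ^ n" for n
  proof -
    have "exp (2 * of_real pi * \<i> * of_nat (Suc n) * (of_nat d * \<tau>)) = exp (of_nat (d * Suc n) * (2 * of_real pi * \<i> * \<tau>))"
      by (simp add: mult_ac del: of_nat_Suc mult_Suc_right)
    also have "\<dots> = q ^ (d * Suc n)"
      unfolding q_def by (rule exp_of_nat_mult)
    also have "\<dots> = q ^ d * (q ^ d) ^ n"
      by (simp add: power_add power_mult)
    finally show ?thesis .
  qed
  thus ?thesis
    unfolding dedekind_eta_def qpoch_def q_def[symmetric] by (simp add: mult_ac)
qed

theorem mainTheorem1:
  fixes N :: nat
  assumes "N > 0"
  shows "\<exists>(r :: rat) (a :: nat \<Rightarrow> int).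
           has_fourier_expansion (saito_eta_product N) r (\<lambda>n. of_int (a n)) \<and>
           (\<forall>n. a n \<ge> 0)"
proof -
  obtain a :: "nat \<Rightarrow> nat" where
    a: "(\<lambda>n. of_nat (a n) * q ^ n) sums level_quotient N q" if "0 < norm q" "norm q < 1" for q
    using nat_power_series_level_quotient[OF assms] unfolding nat_power_series_def by metis
  \<comment> \<open>twenty-four times the exponent of \<open>q\<close> contributed by the factors \<open>exp (pi i tau / 12)\<close>\<close>
  define s where "s = int N * int (totient N) - (\<Sum>d | d dvd N. int d * moebius_mu d)"
  define r :: rat where "r = of_int s / 24"
  have "has_fourier_expansion (saito_eta_product N) r (\<lambda>n. of_int (int (a n)))"
    unfolding has_fourier_expansion_def
  proof (intro allI impI)
    fix \<tau> :: complex assume \<tau>: "Im \<tau> > 0"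
    define q where "q = exp (2 * of_real pi * \<i> * \<tau>)"
    have q: "0 < norm q" "norm q < 1"
      using \<tau> by (auto simp: q_def)
    define c where "c = of_real pi * \<i> * \<tau> / 12"
    have fin: "finite {d. d dvd N}"
      using assms by simp
    have eta: "dedekind_eta (of_nat d * \<tau>) = exp c powi int d * euler_prod (q ^ d)" for d
      unfolding dedekind_eta_mult c_def[symmetric] q_def[symmetric] exp_power_int by (simp only: mult.commute)
    have "(\<Prod>d | d dvd N. dedekind_eta (of_nat d * \<tau>) powi moebius_mu d) =
        (\<Prod>d | d dvd N. exp c powi (int d * moebius_mu d)) * (\<Prod>d | d dvd N. euler_prod (q ^ d) powi moebius_mu d)"
      unfolding eta by (simp add: power_int_mult_distrib power_int_mult prod.distrib)
    also have "\<dots> = exp c powi (\<Sum>d | d dvd N. int d * moebius_mu d) * (\<Prod>a\<in>totatives N. qpoch (q ^ a) (q ^ N))"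
      using q assms fin by (subst moebius_product) (auto simp: prod_power_int)
    finally have den: "(\<Prod>d | d dvd N. dedekind_eta (of_nat d * \<tau>) powi moebius_mu d) =
        exp c powi (\<Sum>d | d dvd N. int d * moebius_mu d) * (\<Prod>a\<in>totatives N. qpoch (q ^ a) (q ^ N))" .
    have num: "dedekind_eta (of_nat N * \<tau>) ^ totient N =
        exp c powi (int N * int (totient N)) * euler_prod (q ^ N) ^ totient N"
      unfolding eta by (simp add: power_mult_distrib power_int_mult)
    have "saito_eta_product N \<tau> = exp c powi s * level_quotient N q"
      unfolding saito_eta_product_def den num level_quotient_def s_def by (simp add: power_int_diff)
    also have "exp c powi s = exp (2 * of_real pi * \<i> * of_rat r * \<tau>)"
      unfolding exp_power_int by (simp add: c_def r_def of_rat_divide mult_ac)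
    finally have "saito_eta_product N \<tau> / exp (2 * of_real pi * \<i> * of_rat r * \<tau>) = level_quotient N q"
      by simp
    thus "(\<lambda>n. of_int (int (a n)) * exp (2 * of_real pi * \<i> * \<tau>) ^ n) sums
        (saito_eta_product N \<tau> / exp (2 * of_real pi * \<i> * of_rat r * \<tau>))"
      using a[OF q] by (simp add: q_def)
  qed
  thus ?thesis
    by (intro exI[of _ r] exI[of _ "\<lambda>n. int (a n)"]) auto
qed

end
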